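(* Let $d\ge1$, $\beta>0$ and let $D$ be any weak $\beta$-LRP metric, with associated constant $\theta$. There exists a positive constant $C_D$ depending only on $d$ and the law of $D$ such that for any $R>0$ and any $M>2^{\theta+d+1}$, $$\mathbb{P}\left[\sup_{\mathbf x,\mathbf x'\in[-R,R]^d}\frac{D(\mathbf x,\mathbf x';[-R,R]^d)}{\|\mathbf x-\mathbf x'\|_\infty^\theta\,\log\frac{4R}{\|\mathbf x-\mathbf x'\|_\infty}}>M\right]\le 2^{d+1}C_D\exp\{-2^{-\theta-1}M\},$$ where the supremum is over distinct points.
   Context: Edge set. $\mathcal E$ is the random set of (undirected) edges $\langle\mathbf x,\mathbf y\rangle$, $\mathbf x,\mathbf y\in\mathbb{R}^d$, given by the atoms of a Poisson point process where edges between $\mathbf x$ and $\mathbf y$ occur with intensity $\beta/|\mathbf x-\mathbf y|^{2d}$ with respect to Lebesgue measure on $\mathbb{R}^{2d}$ (the number of edges between disjoint Borel sets $A,B$ is Poisson with mean $\beta\int_A\int_B|\mathbf u-\mathbf v|^{-2d}d\mathbf u\,d\mathbf v$); $|\cdot|$ is the Euclidean norm and $\|\cdot\|_\infty$ the $\ell^\infty$-norm. Metric notions. For a (pseudo)metric $D$ and a $D$-continuous curve $P:[a,b]\to X$, $\mathrm{len}(P;D)=\sup\sum_i D(P(t_{i-1}),P(t_i))$ over all partitions of $[a,b]$. $(X,D)$ is a length space if for all $x,y\in X$, $\varepsilon>0$ there is a curve from $x$ to $y$ of $D$-length at most $D(x,y)+\varepsilon$; a geodesic from $x$ to $y$ is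 a curve of $D$-length exactly $D(x,y)$. For $Y\subset X$ the internal metric is $D(x,y;Y)=\inf\{\mathrm{len}(P;D): P\text{ a path in }Y\text{ from }x\text{ to }y\}$. $D(x,A)=\inf_{y\in A}D(x,y)$ and $\mathrm{diam}(A;D)=\sup_{x,y\in A}D(x,y;A)$. Weak $\beta$-LRP metric. Let $\mathcal D'$ be the space of measures $\sum_{n=1}^N\delta_{(\mathbf x_n,\mathbf y_n)}$ with $0\le N\le\infty$ and distinct points $(\mathbf x_n,\mathbf y_n)\in\mathbb{R}^{2d}$, with the usual weak topology. A weak $\beta$-LRP metric is a measurable function $\mathcal E\mapsto D$ from $\mathcal D'$ to the space of continuous pseudometrics on $\mathbb{R}^d$ with the local uniform topology such that, for $\mathcal E$ the Poisson edge set above and some constant $\theta=\theta(\beta,d)>0$, the associated $D$ satisfies (almost surely where appropriate): I (length space): with $\mathbf x\sim\mathbf y$ iff $D(\mathbf x,\mathbf y)=0$, $(\mathbb{R}^d/\sim,D)$ is a length space, and there is a geodesic between any two $\mathbf x,\mathbf y\in\mathbb{R}^d$. II (locality): for every deterministic open $U\subset\mathbb{R}^d$, the internal metric $D(\cdot,\cdot;U)$ is determined by $\mathcal E|_{U\times U}$, and is independent of all edges with at least one end point outside $U$. III (regularity): for any $\mathbf x,\mathbf y$, $D(\mathbf x,\mathbf y)=0$ if $\langle\mathbf x,\mathbf y\rangle\in\mathcal E$. IV' (translation invariance): for any $\mathbf z\in\mathbb{R}^d$, $D(\cdot+\mathbf z,\cdot+\mathbf z)$ has the same law as $D(\cdot,\cdot)$.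 V1': the family $\{r^\theta/D(\mathbf 0,([-r,r]^d)^c)\}_{r>0}$ is tight. V2': $\sup_{r>0}\mathbb{E}[\exp\{(\mathrm{diam}([0,r]^d;D)/r^\theta)^\eta\}]<\infty$ for any $\eta\in(0,1/(1-\theta))$ (with $1/(1-\theta)$ read as $+\infty$ if $\theta\ge1$). *)

theory Defs
  imports "HOL-Probability.Probability"
begin

section \<open>Curves, lengths and internal metrics of a pseudometric\<close>

definition pseudometric :: "('b \<Rightarrow> 'b \<Rightarrow> real) \<Rightarrow> bool" where
  "pseudometric D \<longleftrightarrow>
     (\<forall>x y. 0 \<le> D x y) \<and> (\<forall>x. D x x = 0) \<and> (\<forall>x y. D x y = D y x) \<and>
     (\<forall>x y z. D x z \<le> D x y + D y z)"

text \<open>A curve need only be continuous for \<open>D\<close>; when \<open>D\<close> vanishes on a long edge, it may jump along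
  that edge.\<close>

definition path_in ::
  "('b \<Rightarrow> 'b \<Rightarrow> real) \<Rightarrow> 'b set \<Rightarrow> 'b \<Rightarrow> 'b \<Rightarrow> (real \<Rightarrow> 'b) \<Rightarrow> real \<Rightarrow> real \<Rightarrow> bool" where
  "path_in D Y x y P a b \<longleftrightarrow>
     a \<le> b \<and> P ` {a..b} \<subseteq> Y \<and> P a = x \<and> P b = y \<and>
     (\<forall>t\<in>{a..b}. ((\<lambda>s. D (P s) (P t)) \<longlongrightarrow> 0) (at t within {a..b}))"

definition len :: "('b \<Rightarrow> 'b \<Rightarrow> real) \<Rightarrow> (real \<Rightarrow> 'b) \<Rightarrow> real \<Rightarrow> real \<Rightarrow> ennreal" where
  "len D P a b =
     (SUP (n, t) \<in> {(n :: nat, t :: nat \<Rightarrow> real). t 0 = a \<and> t n = b \<and> (\<forall>i<n. t i \<le> t (Suc i))}.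
        \<Sum>i<n. ennreal (D (P (t i)) (P (t (Suc i)))))"

definition length_space :: "'b set \<Rightarrow> ('b \<Rightarrow> 'b \<Rightarrow> real) \<Rightarrow> bool" where
  "length_space X D \<longleftrightarrow>
     (\<forall>x\<in>X. \<forall>y\<in>X. \<forall>\<epsilon>>0. \<exists>P a b. path_in D X x y P a b \<and> len D P a b \<le> ennreal (D x y + \<epsilon>))"

definition geodesic ::
  "('b \<Rightarrow> 'b \<Rightarrow> real) \<Rightarrow> 'b set \<Rightarrow> 'b \<Rightarrow> 'b \<Rightarrow> (real \<Rightarrow> 'b) \<Rightarrow> real \<Rightarrow> real \<Rightarrow> bool" where
  "geodesic D X x y P a b \<longleftrightarrow> path_in D X x y P a b \<and> len D P a b = ennreal (D x y)"

text \<open>The value is \<open>\<top>\<close> if no path of finite length joins \<open>x\<close> to \<open>y\<close> inside \<open>Y\<close>.\<close>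

definition internal_metric :: "('b \<Rightarrow> 'b \<Rightarrow> real) \<Rightarrow> 'b set \<Rightarrow> 'b \<Rightarrow> 'b \<Rightarrow> ennreal" where
  "internal_metric D Y x y = (INF (P, a, b) \<in> {(P, a, b). path_in D Y x y P a b}. len D P a b)"

definition dist_to_set :: "('b \<Rightarrow> 'b \<Rightarrow> real) \<Rightarrow> 'b \<Rightarrow> 'b set \<Rightarrow> ennreal" where
  "dist_to_set D x A = (INF y\<in>A. ennreal (D x y))"

definition diam :: "('b \<Rightarrow> 'b \<Rightarrow> real) \<Rightarrow> 'b set \<Rightarrow> ennreal" where
  "diam D A = (SUP (x, y) \<in> A \<times> A. internal_metric D A x y)"

definition zero_rel :: "('b \<Rightarrow> 'b \<Rightarrow> real) \<Rightarrow> ('b \<times> 'b) set" where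
  "zero_rel D = {(x, y). D x y = 0}"

definition quotient_metric :: "('b \<Rightarrow> 'b \<Rightarrow> real) \<Rightarrow> 'b set \<Rightarrow> 'b set \<Rightarrow> real" where
  "quotient_metric D A B = D (SOME a. a \<in> A) (SOME b. b \<in> B)"

definition cube :: "real \<Rightarrow> real \<Rightarrow> (real ^ 'n) set" where
  "cube a b = cbox (\<chi> i. a) (\<chi> i. b)"


section \<open>The space of continuous pseudometrics\<close>

definition continuous_pseudometrics :: "('b :: metric_space \<Rightarrow> 'b \<Rightarrow> real) set" where
  "continuous_pseudometrics = {D. pseudometric D \<and> continuous_on UNIV (\<lambda>(x, y). D x y)}"

definition local_uniform_topology :: "('b :: metric_space \<Rightarrow> 'b \<Rightarrow> real) topology" where
  "local_uniform_topology = topology_generated_by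
     {{D' \<in> continuous_pseudometrics. \<forall>x\<in>K. \<forall>y\<in>K. \<bar>D' x y - D x y\<bar> < \<epsilon>} | D K \<epsilon>.
        D \<in> continuous_pseudometrics \<and> compact K \<and> 0 < \<epsilon>}"

definition pseudometric_space :: "('b :: metric_space \<Rightarrow> 'b \<Rightarrow> real) measure" where
  "pseudometric_space = sigma continuous_pseudometrics {U. openin local_uniform_topology U}"


section \<open>Edge configurations and the Poisson edge set\<close>

text \<open>The measure \<open>\<Sum>\<^sub>n \<delta>\<^bsub>p\<^sub>n\<^esub>\<close> with distinct atoms \<open>p\<^sub>n\<close> is the image of the counting measure on the
  countable set of its atoms.\<close>

definition edge_configs :: "((real ^ 'n) \<times> (real ^ 'n)) measure set" where
  "edge_configs = {distr (count_space C) borel (\<lambda>p. p) | C. countable C}"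

text \<open>The measurable structure is generated by the evaluations \<open>\<xi> \<mapsto> \<xi> S\<close>, as in
  \<^const>\<open>subprob_algebra\<close>. On locally finite measures this is the Borel \<open>\<sigma>\<close>-algebra of the weak topology;
  it still makes sense for the configurations at hand, which accumulate at the diagonal.\<close>

definition edge_space :: "((real ^ 'n) \<times> (real ^ 'n)) measure measure" where
  "edge_space = (SUP S \<in> sets borel. vimage_algebra edge_configs (\<lambda>\<xi>. emeasure \<xi> S) borel)"

text \<open>An atom \<open>(x, y)\<close> records the undirected edge \<open>\<langle>x, y\<rangle>\<close> with one of its two orientations.\<close>

definition is_edge :: "((real ^ 'n) \<times> (real ^ 'n)) measure \<Rightarrow> real ^ 'n \<Rightarrow> real ^ 'n \<Rightarrow> bool" where
  "is_edge \<xi> x y \<longleftrightarrow> emeasure \<xi> {(x, y)} \<noteq> 0 \<or> emeasure \<xi> {(y, x)} \<noteq> 0"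

definition restrict_edges ::
  "((real ^ 'n) \<times> (real ^ 'n)) set \<Rightarrow> ((real ^ 'n) \<times> (real ^ 'n)) measure \<Rightarrow> ((real ^ 'n) \<times> (real ^ 'n)) measure"
  where "restrict_edges S \<xi> = density \<xi> (indicator S)"

text \<open>The undirected edge \<open>\<langle>x, y\<rangle>\<close> has intensity \<open>\<beta> / |x - y|\<^sup>2\<^sup>d\<close>, shared equally by its two
  orientations; see \<open>edge_intensity_between\<close> below.\<close>

definition edge_intensity :: "real \<Rightarrow> ((real ^ 'n) \<times> (real ^ 'n)) measure" where
  "edge_intensity \<beta> =
     density lborel (\<lambda>(x, y). ennreal (\<beta> / (2 * norm (x - y) ^ (2 * CARD('n)))))"

lemma edge_intensity_between:
  fixes A B :: "(real ^ 'n) set"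
  assumes "0 < \<beta>" and [measurable]: "A \<in> sets borel" "B \<in> sets borel" and "A \<inter> B = {}"
  shows "emeasure (edge_intensity \<beta>) (A \<times> B \<union> B \<times> A) =
    (\<integral>\<^sup>+u\<in>A. (\<integral>\<^sup>+v\<in>B. ennreal (\<beta> / norm (u - v) ^ (2 * CARD('n))) \<partial>lborel) \<partial>lborel)"
proof -
  define f :: "real ^ 'n \<Rightarrow> real ^ 'n \<Rightarrow> ennreal" where
    "f u v = ennreal (\<beta> / (2 * norm (u - v) ^ (2 * CARD('n))))" for u v
  have [measurable]: "case_prod f \<in> borel_measurable (lborel \<Otimes>\<^sub>M lborel)"
    unfolding f_def by measurable
  have f_sym: "f u v = f v u" for u v
    by (simp add: f_def norm_minus_commute)
  have dens: "edge_intensity \<beta> = density (lborel \<Otimes>\<^sub>M lborel) (case_prod f)"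
    unfolding edge_intensity_def f_def lborel_prod ..
  have rect: "emeasure (edge_intensity \<beta>) (S \<times> T) = (\<integral>\<^sup>+u\<in>S. (\<integral>\<^sup>+v\<in>T. f u v \<partial>lborel) \<partial>lborel)"
    if [measurable]: "S \<in> sets borel" "T \<in> sets borel" for S T
  proof -
    have "emeasure (edge_intensity \<beta>) (S \<times> T) =
        (\<integral>\<^sup>+p. case_prod f p * indicator (S \<times> T) p \<partial>(lborel \<Otimes>\<^sub>M lborel))"
      unfolding dens by (subst emeasure_density) auto
    also have "\<dots> = (\<integral>\<^sup>+u. (\<integral>\<^sup>+v. f u v * indicator (S \<times> T) (u, v) \<partial>lborel) \<partial>lborel)"
      by (subst lborel.nn_integral_fst[symmetric]) auto
    also have "\<dots> = (\<integral>\<^sup>+u\<in>S. (\<integral>\<^sup>+v\<in>T. f u v \<partial>lborel) \<partial>lborel)"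
      by (intro nn_integral_cong) (auto simp: indicator_def)
    finally show ?thesis .
  qed
  have swap: "(\<integral>\<^sup>+u\<in>B. (\<integral>\<^sup>+v\<in>A. f u v \<partial>lborel) \<partial>lborel) = (\<integral>\<^sup>+u\<in>A. (\<integral>\<^sup>+v\<in>B. f u v \<partial>lborel) \<partial>lborel)"
  proof -
    have "(\<integral>\<^sup>+u\<in>B. (\<integral>\<^sup>+v\<in>A. f u v \<partial>lborel) \<partial>lborel) =
        (\<integral>\<^sup>+u. (\<integral>\<^sup>+v. f v u * indicator A v * indicator B u \<partial>lborel) \<partial>lborel)"
      by (intro nn_integral_cong) (auto simp: indicator_def f_sym)
    also have "\<dots> = (\<integral>\<^sup>+v. (\<integral>\<^sup>+u. f v u * indicator A v * indicator B u \<partial>lborel) \<partial>lborel)"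
      by (rule lborel_pair.Fubini') measurable
    also have "\<dots> = (\<integral>\<^sup>+u\<in>A. (\<integral>\<^sup>+v\<in>B. f u v \<partial>lborel) \<partial>lborel)"
      by (intro nn_integral_cong) (auto simp: indicator_def)
    finally show ?thesis .
  qed
  have twice: "f u v + f u v = ennreal (\<beta> / norm (u - v) ^ (2 * CARD('n)))" for u v
    using \<open>0 < \<beta>\<close> by (simp add: f_def flip: ennreal_plus)
  have "emeasure (edge_intensity \<beta>) (A \<times> B \<union> B \<times> A) =
      emeasure (edge_intensity \<beta>) (A \<times> B) + emeasure (edge_intensity \<beta>) (B \<times> A)"
    using \<open>A \<inter> B = {}\<close> by (intro plus_emeasure[symmetric]) (auto simp: dens)
  also have "\<dots> = (\<integral>\<^sup>+u\<in>A. (\<integral>\<^sup>+v\<in>B. f u v \<partial>lborel) \<partial>lborel) + (\<integral>\<^sup>+u\<in>A. (\<integral>\<^sup>+v\<in>B. f u v \<partial>lborel) \<partial>lborel)"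
    by (simp add: rect swap)
  also have "\<dots> = (\<integral>\<^sup>+u. (\<integral>\<^sup>+v\<in>B. f u v \<partial>lborel) * indicator A u + (\<integral>\<^sup>+v\<in>B. f u v \<partial>lborel) * indicator A u \<partial>lborel)"
    by (rule nn_integral_add[symmetric]) measurable
  also have "\<dots> = (\<integral>\<^sup>+u\<in>A. (\<integral>\<^sup>+v\<in>B. f u v + f u v \<partial>lborel) \<partial>lborel)"
    by (intro nn_integral_cong) (auto simp: indicator_def distrib_right nn_integral_add)
  finally show ?thesis
    by (simp add: twice)
qed

text \<open>\<open>P\<close> is the law on \<^const>\<open>edge_space\<close> of the Poisson point process with intensity measure
  \<^term>\<open>edge_intensity \<beta>\<close>. The Poisson weights are written out because \<^const>\<open>poisson_pmf\<close> excludes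
  rate \<open>0\<close>.\<close>

definition poisson_edge_law ::
  "real \<Rightarrow> ((real ^ 'n) \<times> (real ^ 'n)) measure measure \<Rightarrow> bool" where
  "poisson_edge_law \<beta> P \<longleftrightarrow>
     prob_space P \<and> sets P = sets edge_space \<and>
     (\<forall>S\<in>sets borel. emeasure (edge_intensity \<beta>) S < \<top> \<longrightarrow>
        (\<forall>k::nat. measure P {\<xi> \<in> space P. emeasure \<xi> S = of_nat k} =
           measure (edge_intensity \<beta>) S ^ k / fact k * exp (- measure (edge_intensity \<beta>) S))) \<and>
     (\<forall>S :: nat \<Rightarrow> ((real ^ 'n) \<times> (real ^ 'n)) set. range S \<subseteq> sets borel \<longrightarrow> disjoint_family S \<longrightarrow>
        prob_space.indep_vars P (\<lambda>_. borel) (\<lambda>i \<xi>. emeasure \<xi> (S i)) UNIV)"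


section \<open>Weak LRP metrics\<close>

text \<open>Throughout, the probability space is the space of edge configurations with its Poisson law \<open>P\<close>,
  so that the random edge set is the identity and \<open>D \<xi>\<close> is the pseudometric associated with \<open>\<xi>\<close>.\<close>

definition length_space_axiom ::
  "((real ^ 'n) \<times> (real ^ 'n)) measure measure \<Rightarrow>
   (((real ^ 'n) \<times> (real ^ 'n)) measure \<Rightarrow> real ^ 'n \<Rightarrow> real ^ 'n \<Rightarrow> real) \<Rightarrow> bool" where
  "length_space_axiom P D \<longleftrightarrow>
     (AE \<xi> in P. length_space (UNIV // zero_rel (D \<xi>)) (quotient_metric (D \<xi>)) \<and>
        (\<forall>x y. \<exists>Q a b. geodesic (D \<xi>) UNIV x y Q a b))"

text \<open>Independence is stated in the completion of \<open>P\<close>: the internal metrics are determined by the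
  edges only up to null sets.\<close>

definition locality_axiom ::
  "((real ^ 'n) \<times> (real ^ 'n)) measure measure \<Rightarrow>
   (((real ^ 'n) \<times> (real ^ 'n)) measure \<Rightarrow> real ^ 'n \<Rightarrow> real ^ 'n \<Rightarrow> real) \<Rightarrow> bool" where
  "locality_axiom P D \<longleftrightarrow>
     (\<forall>U. open U \<longrightarrow>
        (\<exists>F :: ((real ^ 'n) \<times> (real ^ 'n)) measure \<Rightarrow> real ^ 'n \<Rightarrow> real ^ 'n \<Rightarrow> ennreal.
           (\<forall>x\<in>U. \<forall>y\<in>U. (\<lambda>\<xi>. F \<xi> x y) \<in> borel_measurable edge_space) \<and>
           (AE \<xi> in P. \<forall>x\<in>U. \<forall>y\<in>U.
              internal_metric (D \<xi>) U x y = F (restrict_edges (U \<times> U) \<xi>) x y)) \<and>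
        prob_space.indep_set (completion P)
          (sigma_sets (space P)
             {(\<lambda>\<xi>. internal_metric (D \<xi>) U x y) -` B \<inter> space P | x y B.
                x \<in> U \<and> y \<in> U \<and> B \<in> sets borel})
          (sigma_sets (space P)
             {restrict_edges (- (U \<times> U)) -` B \<inter> space P | B. B \<in> sets edge_space}))"

definition regularity_axiom ::
  "((real ^ 'n) \<times> (real ^ 'n)) measure measure \<Rightarrow>
   (((real ^ 'n) \<times> (real ^ 'n)) measure \<Rightarrow> real ^ 'n \<Rightarrow> real ^ 'n \<Rightarrow> real) \<Rightarrow> bool" where
  "regularity_axiom P D \<longleftrightarrow> (AE \<xi> in P. \<forall>x y. is_edge \<xi> x y \<longrightarrow> D \<xi> x y = 0)"

definition law ::
  "((real ^ 'n) \<times> (real ^ 'n)) measure measure \<Rightarrow>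
   (((real ^ 'n) \<times> (real ^ 'n)) measure \<Rightarrow> real ^ 'n \<Rightarrow> real ^ 'n \<Rightarrow> real) \<Rightarrow>
   (real ^ 'n \<Rightarrow> real ^ 'n \<Rightarrow> real) measure" where
  "law P D = distr P pseudometric_space D"

definition translation_invariance_axiom ::
  "((real ^ 'n) \<times> (real ^ 'n)) measure measure \<Rightarrow>
   (((real ^ 'n) \<times> (real ^ 'n)) measure \<Rightarrow> real ^ 'n \<Rightarrow> real ^ 'n \<Rightarrow> real) \<Rightarrow> bool" where
  "translation_invariance_axiom P D \<longleftrightarrow> (\<forall>z. law P (\<lambda>\<xi> x y. D \<xi> (x + z) (y + z)) = law P D)"

text \<open>The quotient is taken in \<^typ>\<open>ennreal\<close>, hence equals \<open>\<top>\<close> when the distance is zero.\<close>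

definition tightness_axiom ::
  "((real ^ 'n) \<times> (real ^ 'n)) measure measure \<Rightarrow> real \<Rightarrow>
   (((real ^ 'n) \<times> (real ^ 'n)) measure \<Rightarrow> real ^ 'n \<Rightarrow> real ^ 'n \<Rightarrow> real) \<Rightarrow> bool" where
  "tightness_axiom P \<theta> D \<longleftrightarrow>
     (\<forall>\<epsilon>>0. \<exists>K::real. \<forall>r>0.
        measure P {\<xi> \<in> space P.
          ennreal (r powr \<theta>) / dist_to_set (D \<xi>) 0 (- cube (- r) r) > ennreal K} \<le> \<epsilon>)"

definition exponential_moment_axiom ::
  "((real ^ 'n) \<times> (real ^ 'n)) measure measure \<Rightarrow> real \<Rightarrow>
   (((real ^ 'n) \<times> (real ^ 'n)) measure \<Rightarrow> real ^ 'n \<Rightarrow> real ^ 'n \<Rightarrow> real) \<Rightarrow> bool" where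
  "exponential_moment_axiom P \<theta> D \<longleftrightarrow>
     (\<forall>\<eta>>0. (\<theta> < 1 \<longrightarrow> \<eta> < 1 / (1 - \<theta>)) \<longrightarrow>
        (SUP r \<in> {0<..}. \<integral>\<^sup>+\<xi>.
           (if diam (D \<xi>) (cube 0 r) = \<top> then \<top>
            else ennreal (exp ((enn2real (diam (D \<xi>) (cube 0 r)) / r powr \<theta>) powr \<eta>))) \<partial>P) < \<top>)"

definition weak_LRP_metric ::
  "real \<Rightarrow> ((real ^ 'n) \<times> (real ^ 'n)) measure measure \<Rightarrow> real \<Rightarrow>
   (((real ^ 'n) \<times> (real ^ 'n)) measure \<Rightarrow> real ^ 'n \<Rightarrow> real ^ 'n \<Rightarrow> real) \<Rightarrow> bool" where
  "weak_LRP_metric \<beta> P \<theta> D \<longleftrightarrow>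
     poisson_edge_law \<beta> P \<and> D \<in> measurable edge_space pseudometric_space \<and> 0 < \<theta> \<and>
     length_space_axiom P D \<and> locality_axiom P D \<and> regularity_axiom P D \<and>
     translation_invariance_axiom P D \<and> tightness_axiom P \<theta> D \<and> exponential_moment_axiom P \<theta> D"

end

theory Submission
  imports Defs
begin

text \<open>Why the bound holds. If \<open>\<delta> = \<parallel>x - x'\<parallel>\<^sub>\<infinity>\<close> is of order \<open>2\<^sup>-\<^sup>n R\<close>, both points lie in a common
  subcube of side \<open>2R / 2\<^sup>n\<close>, taken from a grid whose mesh is half the side; this grid has at most
  \<open>2\<^bsup>d(n+1)\<^esup>\<close> cubes (\<open>common_subcube\<close>). A large ratio at \<open>(x, x')\<close> forces the internal diameter of that
  subcube, divided by the power \<open>\<theta>\<close> of its side, to exceed a multiple of \<open>M (n + 1)\<close>; the factor \<open>n + 1\<close>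
  comes from the logarithm in the denominator. By translation invariance and the exponential moments, this has
  probability at most \<open>C exp (- \<kappa> (n + 1))\<close> with \<open>\<kappa> = 2\<^bsup>-\<theta>-1\<^esup> M > 2\<^sup>d\<close>, so a union bound leaves the
  geometric series with ratio \<open>2\<^sup>d exp (- \<kappa>) \<le> 1/2\<close> (\<open>log_Hoelder_bound_of_diam_tail\<close>).

  The common subcube loses a factor \<open>4\<^sup>\<theta>\<close>, and the logarithm a factor \<open>ln 2\<close>; in general this is more
  than the constant in the exponent allows. It is repaired by the tail of the diameter:
  moments with an exponent \<open>\<eta> > 1\<close> give \<open>exp (- a t)\<close> for every rate \<open>a\<close>, at the price of a larger constant (\<open>law_diam_tail\<close>).

  Two further points need an argument. The constant may depend on the law of \<open>D\<close> but not
  on \<open>\<theta>\<close>; however, the law determines \<open>\<theta>\<close>, because with high probability and up to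
  constants, tightness bounds the diameter of a cube of side \<open>r\<close> from below by \<open>r\<^sup>\<theta>\<close> and the moments
  bound it from above (\<open>exponent_le_of_same_law\<close>). And the event must
  be measurable for the edges themselves, not just up to null sets, although it involves an infimum over
  all curves and a supremum over uncountably many pairs. For a compact set \<open>Y\<close> the internal metric is at
  most \<open>L\<close> iff for every \<open>\<delta>\<close> there is a chain of points of \<open>Y\<close> with \<open>D\<close>-steps below \<open>\<delta>\<close> and total
  length below \<open>L + \<delta>\<close> (\<open>near_chain_of_internal_metric_le\<close> and
  \<open>internal_metric_le_of_near_chains\<close>). The existence of such a chain is an open condition
  on \<open>D\<close>, and the criterion also makes the internal metric lower semicontinuous in the two points, so
  that countably many pairs suffice (\<open>exists_internal_metric_gt_sets\<close>).\<close>

section \<open>Curves and internal metrics\<close>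

lemma pseudometric_facts:
  assumes "pseudometric D"
  shows "0 \<le> D x y" "D x x = 0" "D x y = D y x" "D x z \<le> D x y + D y z"
  using assms unfolding pseudometric_def by blast+

lemma continuous_on_pseudometric:
  assumes "D \<in> continuous_pseudometrics" "continuous_on S f" "continuous_on S g"
  shows "continuous_on S (\<lambda>u. D (f u) (g u))"
proof -
  have "continuous_on UNIV (\<lambda>(x, y). D x y)"
    using assms(1) by (simp add: continuous_pseudometrics_def)
  from continuous_on_compose2[OF this continuous_on_Pair[OF assms(2,3)]] show ?thesis
    by simp
qed

lemma internal_metric_less_path:
  assumes "internal_metric D Y x y < c"
  obtains P a b where "path_in D Y x y P a b" "len D P a b < c"
  using assms unfolding internal_metric_def by (auto simp: INF_less_iff)

lemma internal_metric_le_len: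
  "path_in D Y x y P a b \<Longrightarrow> internal_metric D Y x y \<le> len D P a b"
  unfolding internal_metric_def by (rule INF_lower2[of "(P, a, b)"]) auto

lemma len_ge_partition:
  assumes "t 0 = a" "t n = b" "\<And>i. i < n \<Longrightarrow> t i \<le> t (Suc i)"
  shows "(\<Sum>i<n. ennreal (D (P (t i)) (P (t (Suc i))))) \<le> len D P a b"
  unfolding len_def by (rule SUP_upper2[of "(n, t)"]) (use assms in auto)

lemma dist_le_internal_metric: "ennreal (D x y) \<le> internal_metric D Y x y"
proof -
  have "ennreal (D x y) \<le> len D P a b" if "path_in D Y x y P a b" for P a b
    using len_ge_partition[of "\<lambda>i::nat. if i = 0 then a else b" a 1 b D P] that
    unfolding path_in_def by auto
  then show ?thesis
    unfolding internal_metric_def by (auto intro!: INF_greatest)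
qed

lemma internal_metric_antimono:
  "Q \<subseteq> Y \<Longrightarrow> internal_metric D Y x y \<le> internal_metric D Q x y"
  unfolding internal_metric_def path_in_def by (rule INF_superset_mono) auto

lemma internal_metric_image_le:
  "internal_metric D (f ` Y) (f x) (f y) \<le> internal_metric (\<lambda>u v. D (f u) (f v)) Y x y"
proof -
  have "internal_metric D (f ` Y) (f x) (f y) \<le> len (\<lambda>u v. D (f u) (f v)) P a b"
    if P: "path_in (\<lambda>u v. D (f u) (f v)) Y x y P a b" for P a b
  proof -
    have "path_in D (f ` Y) (f x) (f y) (f \<circ> P) a b"
      using P unfolding path_in_def by auto
    then have "internal_metric D (f ` Y) (f x) (f y) \<le> len D (f \<circ> P) a b"
      by (rule internal_metric_le_len)
    then show ?thesis
      by (simp add: len_def)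
  qed
  then show ?thesis
    unfolding internal_metric_def[of "\<lambda>u v. D (f u) (f v)"] by (auto intro!: INF_greatest)
qed

lemma diam_image_le: "diam D (f ` Y) \<le> diam (\<lambda>u v. D (f u) (f v)) Y"
  unfolding diam_def
proof (rule SUP_least, clarsimp)
  fix x y assume "x \<in> Y" "y \<in> Y"
  then show "internal_metric D (f ` Y) (f x) (f y)
      \<le> (SUP (x, y)\<in>Y \<times> Y. internal_metric (\<lambda>u v. D (f u) (f v)) Y x y)"
    by (intro SUP_upper2[of "(x, y)"]) (auto intro: internal_metric_image_le)
qed

lemma internal_metric_le_diam: "x \<in> Y \<Longrightarrow> y \<in> Y \<Longrightarrow> internal_metric D Y x y \<le> diam D Y"
  unfolding diam_def by (rule SUP_upper2[of "(x, y)"]) auto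

section \<open>Fine chains approximate curves\<close>

text \<open>The discrete substitute for a curve from \<open>x\<close> to \<open>y\<close> of length \<open>L\<close>. Strict inequalities make it an
  open condition on \<open>D\<close>, and leaving the end points free up to \<open>\<delta>\<close> makes it stable when \<open>x\<close> and \<open>y\<close>
  move.\<close>

definition near_chain :: "('b \<Rightarrow> 'b \<Rightarrow> real) \<Rightarrow> 'b set \<Rightarrow> 'b \<Rightarrow> 'b \<Rightarrow> real \<Rightarrow> real \<Rightarrow> bool" where
  "near_chain D Y x y \<delta> L \<longleftrightarrow> (\<exists>m p. p ` {..m} \<subseteq> Y \<and> D x (p 0) < \<delta> \<and> D (p m) y < \<delta> \<and>
     (\<forall>i<m. D (p i) (p (Suc i)) < \<delta>) \<and> (\<Sum>i<m. D (p i) (p (Suc i))) < L + \<delta>)"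

lemma near_chain_move_ends:
  assumes "pseudometric D" "near_chain D Y x' y' \<delta> L" "D x x' < \<epsilon>" "D y y' < \<epsilon>" "0 \<le> \<epsilon>"
    "L + \<delta> \<le> L' + \<delta>'" "\<delta> + \<epsilon> \<le> \<delta>'"
  shows "near_chain D Y x y \<delta>' L'"
proof -
  note D = pseudometric_facts[OF assms(1)]
  obtain m p where mp: "p ` {..m} \<subseteq> Y" "D x' (p 0) < \<delta>" "D (p m) y' < \<delta>"
     "\<And>i. i<m \<Longrightarrow> D (p i) (p (Suc i)) < \<delta>" "(\<Sum>i<m. D (p i) (p (Suc i))) < L + \<delta>"
    using assms(2) unfolding near_chain_def by blast
  have "D x (p 0) < \<delta>'" using mp assms D(4)[of x "p 0" x'] by linarith
  moreover have "D (p m) y < \<delta>'" using mp assms D(4)[of "p m" y y'] D(3)[of y y'] by linarith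
  moreover have "\<forall>i<m. D (p i) (p (Suc i)) < \<delta>'" using mp(4) assms(5,7) by fastforce
  ultimately show ?thesis unfolding near_chain_def using mp assms by (intro exI[of _ m] exI[of _ p]) auto
qed

text \<open>A curve that is continuous for \<open>D\<close> is uniformly continuous, by a Lebesgue number of the cover of
  the parameter interval by intervals of small oscillation.\<close>

lemma fine_partition:
  fixes a b \<delta> :: real
  assumes cont: "\<And>t. t \<in> {a..b} \<Longrightarrow> ((\<lambda>s. D (P s) (P t)) \<longlongrightarrow> 0) (at t within {a..b})"
    and D: "pseudometric D" and "a \<le> b" "0 < \<delta>"
  shows "\<exists>n t. t 0 = a \<and> t n = b \<and> (\<forall>i\<le>n. t i \<in> {a..b}) \<and>
    (\<forall>i<n. t i \<le> t (Suc i) \<and> D (P (t i)) (P (t (Suc i))) < \<delta>)"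
proof -
  note D' = pseudometric_facts[OF D]
  have "\<exists>e>0. \<forall>s\<in>{a..b}. dist s t < e \<longrightarrow> D (P s) (P t) < \<delta> / 2" if "t \<in> {a..b}" for t
  proof -
    have "eventually (\<lambda>s. D (P s) (P t) < \<delta> / 2) (at t within {a..b})"
      using order_tendstoD(2)[OF cont[OF that], of "\<delta>/2"] \<open>0 < \<delta>\<close> by simp
    then obtain e where "e > 0" "\<forall>s\<in>{a..b}. s \<noteq> t \<and> dist s t < e \<longrightarrow> D (P s) (P t) < \<delta> / 2"
      unfolding eventually_at by blast
    then show ?thesis using D'(2) \<open>0 < \<delta>\<close> by (intro exI[of _ e]) auto
  qed
  then obtain e where e: "\<And>t. t \<in> {a..b} \<Longrightarrow> e t > 0"
    "\<And>s t. t \<in> {a..b} \<Longrightarrow> s \<in> {a..b} \<Longrightarrow> dist s t < e t \<Longrightarrow> D (P s) (P t) < \<delta> / 2"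
    by metis
  have "{a..b} \<subseteq> \<Union> ((\<lambda>t. ball t (e t)) ` {a..b})" using e(1) by force
  then obtain \<epsilon> where "\<epsilon> > 0" and \<epsilon>: "\<And>x. x \<in> {a..b} \<Longrightarrow> \<exists>G \<in> (\<lambda>t. ball t (e t)) ` {a..b}. ball x \<epsilon> \<subseteq> G"
    by (rule Heine_Borel_lemma[OF compact_Icc]) auto
  have close: "D (P s) (P t) < \<delta>" if st: "s \<in> {a..b}" "t \<in> {a..b}" "dist s t < \<epsilon>" for s t
  proof -
    obtain c where "c \<in> {a..b}" and sub: "ball s \<epsilon> \<subseteq> ball c (e c)"
      using \<epsilon>[OF st(1)] by blast
    moreover have "s \<in> ball s \<epsilon>" "t \<in> ball s \<epsilon>" using \<open>\<epsilon> > 0\<close> that by auto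
    ultimately have "s \<in> ball c (e c)" "t \<in> ball c (e c)" by blast+
    then have "dist s c < e c" "dist t c < e c" by (simp_all add: dist_commute)
    then have "D (P s) (P c) < \<delta> / 2" "D (P t) (P c) < \<delta> / 2" using e(2) \<open>c \<in> {a..b}\<close> that by auto
    then show ?thesis using D'(4)[of "P s" "P t" "P c"] D'(3)[of "P t" "P c"] by linarith
  qed
  obtain n :: nat where n: "(b - a) / \<epsilon> < real n" using reals_Archimedean2 by blast
  then have n0: "n > 0" using \<open>a \<le> b\<close> \<open>\<epsilon> > 0\<close> by (metis divide_nonneg_pos diff_ge_0_iff_ge leD of_nat_0 gr0I)
  have step: "(b - a) / n < \<epsilon>" using n n0 \<open>\<epsilon> > 0\<close> by (simp add: field_simps)
  define t where "t i = a + real i * ((b - a) / n)" for i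
  have in_ab: "t i \<in> {a..b}" if "i \<le> n" for i
  proof -
    have "real i * ((b - a) / n) \<le> real n * ((b - a) / n)"
      using that \<open>a \<le> b\<close> by (intro mult_right_mono) auto
    then show ?thesis using n0 \<open>a \<le> b\<close> by (auto simp: t_def)
  qed
  have diff: "t (Suc i) - t i = (b - a) / n" for i by (simp add: t_def distrib_right del: times_divide_eq_right)
  have mono: "t i \<le> t (Suc i)" for i
    using diff[of i] \<open>a \<le> b\<close> by (smt (verit) divide_nonneg_nonneg of_nat_0_le_iff)
  have "D (P (t i)) (P (t (Suc i))) < \<delta>" if "i < n" for i
    using close[of "t i" "t (Suc i)"] in_ab that diff[of i] step mono[of i] by (simp add: dist_real_def)
  moreover have "t 0 = a" "t n = b" using n0 by (simp_all add: t_def)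
  ultimately show ?thesis using in_ab mono by blast
qed

lemma near_chain_of_internal_metric_le:
  assumes D: "pseudometric D" and "0 < \<delta>" "0 \<le> L" and le: "internal_metric D Y x y \<le> ennreal L"
  shows "near_chain D Y x y \<delta> L"
proof -
  note D' = pseudometric_facts[OF D]
  have "internal_metric D Y x y < ennreal (L + \<delta>)"
    using le assms by (elim le_less_trans) (simp add: ennreal_less_iff)
  then obtain P a b where P: "path_in D Y x y P a b" "len D P a b < ennreal (L + \<delta>)"
    by (rule internal_metric_less_path)
  then have Pf: "a \<le> b" "P ` {a..b} \<subseteq> Y" "P a = x" "P b = y"
    "\<And>t. t \<in> {a..b} \<Longrightarrow> ((\<lambda>s. D (P s) (P t)) \<longlongrightarrow> 0) (at t within {a..b})"
    unfolding path_in_def by auto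
  obtain n t where t: "t 0 = a" "t n = b" "\<And>i. i < n \<Longrightarrow> t i \<le> t (Suc i)" "\<And>i. i \<le> n \<Longrightarrow> t i \<in> {a..b}"
    "\<And>i. i < n \<Longrightarrow> D (P (t i)) (P (t (Suc i))) < \<delta>"
    using fine_partition[of a b D P \<delta>, OF Pf(5) D Pf(1) \<open>0 < \<delta>\<close>] by auto
  have "ennreal (\<Sum>i<n. D (P (t i)) (P (t (Suc i)))) = (\<Sum>i<n. ennreal (D (P (t i)) (P (t (Suc i)))))"
    using D'(1) by (simp add: sum_ennreal)
  also have "\<dots> < ennreal (L + \<delta>)"
    using len_ge_partition[of t a n b D P] t P(2) by auto
  finally have "(\<Sum>i<n. D (P (t i)) (P (t (Suc i)))) < L + \<delta>"
    using D'(1) by (subst (asm) ennreal_less_iff) (auto intro: sum_nonneg)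
  then show ?thesis
    unfolding near_chain_def using t Pf D'(2) \<open>0 < \<delta>\<close>
    by (intro exI[of _ n] exI[of _ "\<lambda>i. P (t i)"]) auto
qed

text \<open>Walking along the chain at unit speed: at time \<open>t\<close> the walker stands at the last point whose
  distance along the chain is at most \<open>t\<close>. The resulting step function is 1-Lipschitz up to one step of
  the chain.\<close>

lemma step_curve_of_near_chain:
  assumes D: "pseudometric D" and "near_chain D Y x y \<delta> L" "0 \<le> L"
  obtains f :: "real \<Rightarrow> 'b" where "range f \<subseteq> Y" "D x (f 0) \<le> \<delta>" "D (f L) y \<le> 3 * \<delta>"
    "\<And>s t. 0 \<le> s \<Longrightarrow> s \<le> t \<Longrightarrow> D (f s) (f t) \<le> t - s + \<delta>"
proof -
  note D' = pseudometric_facts[OF D]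
  obtain m p where mp: "p ` {..m} \<subseteq> Y" "D x (p 0) < \<delta>" "D (p m) y < \<delta>"
     "\<And>i. i<m \<Longrightarrow> D (p i) (p (Suc i)) < \<delta>" "(\<Sum>i<m. D (p i) (p (Suc i))) < L + \<delta>"
    using assms(2) unfolding near_chain_def by blast
  define s where "s k = (\<Sum>i<k. D (p i) (p (Suc i)))" for k
  have s_Suc: "s (Suc k) = s k + D (p k) (p (Suc k))" for k by (simp add: s_def)
  have tri: "D (p i) (p j) \<le> s j - s i" if "i \<le> j" for i j
    using that
  proof (induction j rule: dec_induct)
    case base then show ?case by (simp add: D'(2))
  next
    case (step j) then show ?case using D'(4)[of "p i" "p (Suc j)" "p j"] s_Suc[of j] by linarith
  qed
  have s_mono: "i \<le> j \<Longrightarrow> s i \<le> s j" for i j using tri[of i j] D'(1)[of "p i" "p j"] by linarith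
  define K where "K t = {i. i \<le> m \<and> s i \<le> t}" for t
  define I where "I t = Max (K (max t 0))" for t
  have K: "finite (K t)" "0 \<le> t \<Longrightarrow> 0 \<in> K t" for t by (auto simp: K_def s_def)
  have I_in: "I t \<in> K (max t 0)" for t
    unfolding I_def using K[of "max t 0"] by (intro Max_in) auto
  have \<delta>: "0 < \<delta>" using mp(2) D'(1)[of x "p 0"] by linarith
  have I_next: "s (Suc (I t)) > t" if "0 \<le> t" "I t < m" for t
  proof (rule ccontr)
    assume "\<not> ?thesis"
    then have "Suc (I t) \<in> K t" using that by (simp add: K_def)
    then have "Suc (I t) \<le> I t" using K(1)[of t] that by (simp add: I_def)
    then show False by simp
  qed
  have low: "t - \<delta> < s (I t) \<or> I t = m" if "0 \<le> t" for t
    using I_next[of t] that I_in[of t] s_Suc[of "I t"] mp(4)[of "I t"] by (force simp: K_def)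
  have I_mono: "I u \<le> I t" if "0 \<le> u" "u \<le> t" for u t
    unfolding I_def using that K by (intro Max_mono) (auto simp: K_def)
  have Im: "I t \<le> m" for t using I_in[of t] by (auto simp: K_def)
  have up: "s (I t) \<le> t" if "0 \<le> t" for t using I_in[of t] that by (auto simp: K_def)
  show thesis
  proof (rule that[of "\<lambda>t. p (I t)"])
    show "range (\<lambda>t. p (I t)) \<subseteq> Y" using mp(1) Im by auto
    show "D (p (I u)) (p (I t)) \<le> t - u + \<delta>" if "0 \<le> u" "u \<le> t" for u t
    proof (cases "I u = m")
      case True
      then have "I t = m" using I_mono[OF that] Im[of t] by simp
      then show ?thesis using True that \<delta> D'(2) by simp
    next
      case False
      then show ?thesis using low[of u] up[of t] tri[OF I_mono[OF that]] that by linarith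
    qed
    have "D (p 0) (p (I 0)) \<le> 0" using tri[of 0 "I 0"] up[of 0] by (simp add: s_def)
    then show "D x (p (I 0)) \<le> \<delta>" using D'(4)[of x "p (I 0)" "p 0"] mp(2) by linarith
    have "D (p (I L)) (p m) \<le> 2 * \<delta>"
    proof (cases "I L = m")
      case True then show ?thesis using \<delta> D'(2) by simp
    next
      case False
      then show ?thesis using low[OF \<open>0 \<le> L\<close>] tri[OF Im[of L]] mp(5) by (simp add: s_def)
    qed
    then show "D (p (I L)) y \<le> 3 * \<delta>" using D'(4)[of "p (I L)" y "p m"] mp(3) by linarith
  qed
qed

text \<open>Closed inequalities pass to cluster points of a sequence, even if they hold only up to a null
  sequence. This replaces the extraction of a convergent subsequence, which need not exist in an
  uncountable product.\<close>

lemma cluster_point_bound: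
  fixes \<Phi> :: "'c::topological_space \<Rightarrow> real"
  assumes "inf (nhds g) (filtermap f sequentially) \<noteq> bot" "continuous_on UNIV \<Phi>"
    "\<And>n. \<Phi> (f n) \<le> c + a n" "a \<longlonglongrightarrow> 0"
  shows "\<Phi> g \<le> c"
proof (rule ccontr)
  assume less: "\<not> \<Phi> g \<le> c"
  define e where "e = (\<Phi> g - c) / 2"
  have "e > 0" "c + e < \<Phi> g" using less by (auto simp: e_def field_simps)
  have "(\<Phi> \<longlongrightarrow> \<Phi> g) (nhds g)"
    using assms(2) by (simp add: continuous_on_def tendsto_at_iff_tendsto_nhds)
  then have "eventually (\<lambda>h. c + e < \<Phi> h) (nhds g)"
    using \<open>c + e < \<Phi> g\<close> by (rule order_tendstoD)
  moreover have "eventually (\<lambda>n. a n < e) sequentially"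
    using assms(4) \<open>e > 0\<close> by (rule order_tendstoD)
  then have "eventually (\<lambda>n. \<Phi> (f n) < c + e) sequentially"
    by eventually_elim (rule le_less_trans[OF assms(3)], simp)
  then have "eventually (\<lambda>h. \<Phi> h < c + e) (filtermap f sequentially)"
    by (simp add: eventually_filtermap)
  ultimately have "eventually (\<lambda>h. False) (inf (nhds g) (filtermap f sequentially))"
    unfolding eventually_inf by (force intro: less_asym)
  then show False using assms(1) by (simp add: eventually_False)
qed

text \<open>The curve need only reach points at \<open>D\<close>-distance zero from \<open>x\<close> and \<open>y\<close>: a curve may jump
  between such points at no cost.\<close>

lemma internal_metric_le_lipschitz:
  assumes D: "pseudometric D" and "0 \<le> L"
    and f: "f ` {0..L} \<subseteq> Y" "D x (f 0) = 0" "D (f L) y = 0" "x \<in> Y" "y \<in> Y"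
      "\<And>s t. 0 \<le> s \<Longrightarrow> s \<le> t \<Longrightarrow> t \<le> L \<Longrightarrow> D (f s) (f t) \<le> t - s"
  shows "internal_metric D Y x y \<le> ennreal L"
proof -
  note D' = pseudometric_facts[OF D]
  \<comment> \<open>The curve waits at \<open>x\<close> before time 0 and at \<open>y\<close> after time \<open>L\<close>; \<open>g\<close> clamps the time to \<open>[0, L]\<close>.\<close>
  define P where "P t = (if t < 0 then x else if t \<le> L then f t else y)" for t
  define g where "g t = max 0 (min t L)" for t
  have gP: "D (P t) (f (g t)) = 0" for t
    using f(2,3) D'(2,3) \<open>0 \<le> L\<close> by (auto simp: P_def g_def)
  have PP: "D (P s) (P t) \<le> g t - g s" if "s \<le> t" for s t
  proof -
    have "D (f (g s)) (f (g t)) \<le> g t - g s" using that \<open>0 \<le> L\<close> by (intro f) (auto simp: g_def)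
    then show ?thesis
      using D'(4)[of "P s" "P t" "f (g s)"] D'(4)[of "f (g s)" "P t" "f (g t)"] gP[of s] gP[of t]
        D'(3)[of "P t" "f (g t)"] by linarith
  qed
  have g1: "g t - g s \<le> t - s" if "s \<le> t" for s t using that by (auto simp: g_def)
  have PPabs: "D (P s) (P t) \<le> \<bar>s - t\<bar>" for s t
  proof (cases "s \<le> t")
    case True then show ?thesis using PP[OF True] g1[OF True] by linarith
  next
    case False then show ?thesis using PP[of t s] g1[of t s] D'(3)[of "P s" "P t"] by linarith
  qed
  have "path_in D Y x y P (-1) (L + 1)"
    unfolding path_in_def
  proof (intro conjI ballI)
    show "P ` {-1..L+1} \<subseteq> Y" using f by (auto simp: P_def)
    fix t :: real
    have "((\<lambda>s. \<bar>s - t\<bar>) \<longlongrightarrow> \<bar>t - t\<bar>) (at t within {-1..L+1})" by (intro tendsto_intros)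
    then have "((\<lambda>s. \<bar>s - t\<bar>) \<longlongrightarrow> 0) (at t within {-1..L+1})" by simp
    then show "((\<lambda>s. D (P s) (P t)) \<longlongrightarrow> 0) (at t within {-1..L+1})"
      by (rule tendsto_sandwich[rotated 3]) (rule always_eventually allI D'(1) PPabs tendsto_const)+
  qed (use \<open>0 \<le> L\<close> in \<open>auto simp: P_def\<close>)
  then have "internal_metric D Y x y \<le> len D P (-1) (L + 1)" by (rule internal_metric_le_len)
  also have "\<dots> \<le> ennreal L"
    unfolding len_def
  proof (rule SUP_least, clarify)
    fix n and t :: "nat \<Rightarrow> real" assume t: "t 0 = -1" "t n = L + 1" "\<forall>i<n. t i \<le> t (Suc i)"
    have "(\<Sum>i<n. D (P (t i)) (P (t (Suc i)))) \<le> (\<Sum>i<n. g (t (Suc i)) - g (t i))"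
      using t PP by (intro sum_mono) auto
    also have "\<dots> = g (t n) - g (t 0)" by (rule sum_lessThan_telescope)
    also have "\<dots> = L" using t \<open>0 \<le> L\<close> by (simp add: g_def)
    finally show "(\<Sum>i<n. ennreal (D (P (t i)) (P (t (Suc i))))) \<le> ennreal L"
      using D'(1) by (simp add: sum_ennreal ennreal_leI)
  qed
  finally show ?thesis .
qed

text \<open>Compactness in the style of Arzela and Ascoli. The step curves of ever finer chains have a cluster
  point in the product \<open>Y\<^bsup>\<real>\<^esup>\<close>, compact by Tychonoff's theorem; it is a 1-Lipschitz curve, since each
  Lipschitz inequality involves two coordinates only.\<close>

lemma internal_metric_le_of_near_chains:
  fixes D :: "'b::metric_space \<Rightarrow> 'b \<Rightarrow> real"
  assumes D: "D \<in> continuous_pseudometrics" and Y: "compact Y" "x \<in> Y" "y \<in> Y" and "0 \<le> L"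
    and chains: "\<And>\<delta>. 0 < \<delta> \<Longrightarrow> near_chain D Y x y \<delta> L"
  shows "internal_metric D Y x y \<le> ennreal L"
proof -
  have pD: "pseudometric D"
    using D by (simp add: continuous_pseudometrics_def)
  note D' = pseudometric_facts[OF pD]
  define \<delta> where "\<delta> n = inverse (real (Suc n))" for n
  have \<delta>: "0 < \<delta> n" for n by (simp add: \<delta>_def)
  have "\<exists>f. range f \<subseteq> Y \<and> D x (f 0) \<le> \<delta> n \<and> D (f L) y \<le> 3 * \<delta> n \<and>
      (\<forall>s t. 0 \<le> s \<longrightarrow> s \<le> t \<longrightarrow> D (f s) (f t) \<le> t - s + \<delta> n)" for n
    using step_curve_of_near_chain[OF pD chains[OF \<delta>[of n]] \<open>0 \<le> L\<close>] by metis
  then obtain f where f: "\<And>n. range (f n) \<subseteq> Y" "\<And>n. D x (f n 0) \<le> \<delta> n" "\<And>n. D (f n L) y \<le> 3 * \<delta> n"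
    "\<And>n s t. 0 \<le> s \<Longrightarrow> s \<le> t \<Longrightarrow> D (f n s) (f n t) \<le> t - s + \<delta> n"
    by metis
  have "compact (PiE UNIV (\<lambda>_::real. Y))"
    using compactin_PiE[of "\<lambda>_::real. euclidean" UNIV "\<lambda>_. Y"] Y
    by (simp add: euclidean_product_topology)
  moreover have "eventually (\<lambda>h. h \<in> PiE UNIV (\<lambda>_::real. Y)) (filtermap f sequentially)"
    using f(1) by (intro always_eventually[THEN eventually_filtermap[THEN iffD2]]) (auto simp: PiE_UNIV_domain)
  ultimately obtain g where gY: "g \<in> PiE UNIV (\<lambda>_::real. Y)" and g: "inf (nhds g) (filtermap f sequentially) \<noteq> bot"
    unfolding compact_filter by (metis filtermap_bot_iff sequentially_bot)
  have \<delta>0: "\<delta> \<longlonglongrightarrow> 0" unfolding \<delta>_def by (rule LIMSEQ_inverse_real_of_nat)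
  have lim: "D (u g) (v g) \<le> c"
    if "\<And>n. D (u (f n)) (v (f n)) \<le> c + k * \<delta> n" "continuous_on UNIV u" "continuous_on UNIV v" for u v c k
  proof (rule cluster_point_bound[OF g])
    show "continuous_on UNIV (\<lambda>h. D (u h) (v h))"
      by (rule continuous_on_pseudometric[OF D that(2,3)])
    show "(\<lambda>n. k * \<delta> n) \<longlonglongrightarrow> 0" using tendsto_mult_right_zero[OF \<delta>0] .
  qed (use that in auto)
  have "D x (g 0) \<le> 0" using lim[of "\<lambda>_. x" "\<lambda>h. h 0" 0 1] f(2) by auto
  then have "D x (g 0) = 0" using D'(1)[of x "g 0"] by linarith
  moreover have "D (g L) y \<le> 0" using lim[of "\<lambda>h. h L" "\<lambda>_. y" 0 3] f(3) by auto
  then have "D (g L) y = 0" using D'(1)[of "g L" y] by linarith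
  moreover have "D (g s) (g t) \<le> t - s" if "0 \<le> s" "s \<le> t" for s t
    using lim[of "\<lambda>h. h s" "\<lambda>h. h t" "t - s" 1] f(4)[OF that] by auto
  ultimately show ?thesis
    using gY Y \<open>0 \<le> L\<close> by (intro internal_metric_le_lipschitz[OF pD, of L g]) auto
qed

text \<open>If no \<open>\<delta>\<close>-chain joins \<open>x\<close> to \<open>y\<close>, then no \<open>\<delta>/2\<close>-chain joins points within \<open>\<delta>/2\<close> of them.\<close>

lemma internal_metric_lower_semicontinuous:
  fixes D :: "'b::metric_space \<Rightarrow> 'b \<Rightarrow> real"
  assumes D: "D \<in> continuous_pseudometrics" and Y: "compact Y" "x \<in> Y" "y \<in> Y" and "0 \<le> L"
    and gt: "ennreal L < internal_metric D Y x y"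
  obtains \<epsilon> where "0 < \<epsilon>"
    "\<And>x' y'. D x x' < \<epsilon> \<Longrightarrow> D y y' < \<epsilon> \<Longrightarrow> ennreal (L + \<epsilon>) < internal_metric D Y x' y'"
proof -
  have pD: "pseudometric D" using D by (auto simp: continuous_pseudometrics_def)
  obtain \<delta> where "0 < \<delta>" and \<delta>: "\<not> near_chain D Y x y \<delta> L"
    using internal_metric_le_of_near_chains[OF D Y \<open>0 \<le> L\<close>] gt by (meson leD)
  show thesis
  proof (rule that[of "\<delta> / 2"])
    fix x' y' assume *: "D x x' < \<delta> / 2" "D y y' < \<delta> / 2"
    show "ennreal (L + \<delta> / 2) < internal_metric D Y x' y'"
    proof (rule ccontr)
      assume "\<not> ?thesis"
      then have "near_chain D Y x' y' (\<delta> / 2) (L + \<delta> / 2)"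
        using \<open>0 < \<delta>\<close> \<open>0 \<le> L\<close> by (intro near_chain_of_internal_metric_le[OF pD]) auto
      then have "near_chain D Y x y \<delta> L"
        by (rule near_chain_move_ends[OF pD _ *]) (use \<open>0 < \<delta>\<close> in auto)
      then show False using \<delta> by simp
    qed
  qed (use \<open>0 < \<delta>\<close> in auto)
qed

section \<open>Measurable sets of pseudometrics\<close>

lemma topspace_local_uniform_topology: "topspace local_uniform_topology = continuous_pseudometrics"
  unfolding local_uniform_topology_def topology_generated_by_topspace
proof (intro equalityI subsetI)
  fix D :: "'b::metric_space \<Rightarrow> 'b \<Rightarrow> real" assume "D \<in> continuous_pseudometrics"
  then show "D \<in> \<Union> {{D' \<in> continuous_pseudometrics. \<forall>x\<in>K. \<forall>y\<in>K. \<bar>D' x y - D x y\<bar> < \<epsilon>} | D K \<epsilon>.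
        D \<in> continuous_pseudometrics \<and> compact K \<and> 0 < \<epsilon>}"
    by (intro UnionI[of "{D' \<in> continuous_pseudometrics. \<forall>x\<in>{}. \<forall>y\<in>{}. \<bar>D' x y - D x y\<bar> < 1}"])
      (auto intro!: exI[of _ D] exI[of _ "{}"] exI[of _ "1::real"])
qed auto

lemma space_pseudometric_space [simp]: "space pseudometric_space = continuous_pseudometrics"
  unfolding pseudometric_space_def by (simp add: space_measure_of_conv)

lemma opens_subset_continuous_pseudometrics:
  "{U. openin local_uniform_topology U} \<subseteq> Pow continuous_pseudometrics"
  using openin_subset topspace_local_uniform_topology by fastforce

lemma openin_sets_pseudometric_space:
  "openin local_uniform_topology U \<Longrightarrow> U \<in> sets pseudometric_space"
  unfolding pseudometric_space_def
  by (intro in_measure_of[OF opens_subset_continuous_pseudometrics]) simp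

lemma openin_local_uniformI:
  assumes "S \<subseteq> continuous_pseudometrics"
    and nbhd: "\<And>D. D \<in> S \<Longrightarrow> \<exists>K \<epsilon>. compact K \<and> 0 < \<epsilon> \<and>
      (\<forall>D'\<in>continuous_pseudometrics. (\<forall>x\<in>K. \<forall>y\<in>K. \<bar>D' x y - D x y\<bar> < \<epsilon>) \<longrightarrow> D' \<in> S)"
  shows "openin local_uniform_topology S"
proof (subst openin_subopen, intro ballI)
  fix D assume "D \<in> S"
  then obtain K \<epsilon> where K: "compact K" "0 < \<epsilon>"
    "\<forall>D'\<in>continuous_pseudometrics. (\<forall>x\<in>K. \<forall>y\<in>K. \<bar>D' x y - D x y\<bar> < \<epsilon>) \<longrightarrow> D' \<in> S"
    using nbhd by blast
  let ?T = "{D' \<in> continuous_pseudometrics. \<forall>x\<in>K. \<forall>y\<in>K. \<bar>D' x y - D x y\<bar> < \<epsilon>}"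
  have "openin local_uniform_topology ?T"
    unfolding local_uniform_topology_def
    using K \<open>D \<in> S\<close> assms(1) by (intro topology_generated_by_Basis) blast
  moreover have "D \<in> ?T" "?T \<subseteq> S" using K \<open>D \<in> S\<close> assms(1) by auto
  ultimately show "\<exists>T. openin local_uniform_topology T \<and> D \<in> T \<and> T \<subseteq> S" by blast
qed

text \<open>A chain has finitely many points, so it survives a perturbation of \<open>D\<close> that is small on this
  finite set, compared with the slack in the finitely many strict inequalities.\<close>

lemma openin_near_chain:
  "openin local_uniform_topology {D \<in> continuous_pseudometrics. near_chain D Y x y \<delta> L}"
proof (rule openin_local_uniformI; clarify?)
  fix D assume "D \<in> continuous_pseudometrics" "near_chain D Y x y \<delta> L"
  then obtain m p where mp: "p ` {..m} \<subseteq> Y" "D x (p 0) < \<delta>" "D (p m) y < \<delta>"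
     "\<And>i. i<m \<Longrightarrow> D (p i) (p (Suc i)) < \<delta>" "(\<Sum>i<m. D (p i) (p (Suc i))) < L + \<delta>"
    unfolding near_chain_def by blast
  have small: "\<forall>\<^sub>F e in at_right 0. c + e < d" if "c < d" for c d :: real
  proof -
    have "((\<lambda>e. c + e) \<longlongrightarrow> c + 0) (at_right 0)" by (intro tendsto_intros)
    then show ?thesis using that by (intro order_tendstoD(2)) auto
  qed
  have "((\<lambda>e. \<Sum>i<m. D (p i) (p (Suc i)) + e) \<longlongrightarrow> (\<Sum>i<m. D (p i) (p (Suc i)) + 0)) (at_right 0)"
    by (intro tendsto_intros)
  then have "\<forall>\<^sub>F e in at_right 0. (\<Sum>i<m. D (p i) (p (Suc i)) + e) < L + \<delta>"
    using mp(5) by (intro order_tendstoD(2)) auto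
  moreover have "\<forall>\<^sub>F e in at_right 0. \<forall>i\<in>{..<m}. D (p i) (p (Suc i)) + e < \<delta>"
    using mp(4) small by (subst eventually_ball_finite_distrib) auto
  ultimately have "\<forall>\<^sub>F e in at_right 0. 0 < e \<and> D x (p 0) + e < \<delta> \<and> D (p m) y + e < \<delta> \<and>
      (\<forall>i\<in>{..<m}. D (p i) (p (Suc i)) + e < \<delta>) \<and> (\<Sum>i<m. D (p i) (p (Suc i)) + e) < L + \<delta>"
    using small[OF mp(2)] small[OF mp(3)] eventually_at_right_less[of "0::real"]
    by eventually_elim simp
  then obtain e where e: "0 < e" "D x (p 0) + e < \<delta>" "D (p m) y + e < \<delta>"
      "\<And>i. i < m \<Longrightarrow> D (p i) (p (Suc i)) + e < \<delta>" "(\<Sum>i<m. D (p i) (p (Suc i)) + e) < L + \<delta>"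
    using eventually_happens'[OF trivial_limit_at_right_real] by blast
  let ?K = "{x, y} \<union> p ` {..m}"
  have "near_chain D' Y x y \<delta> L" if close: "\<forall>x\<in>?K. \<forall>y\<in>?K. \<bar>D' x y - D x y\<bar> < e" for D'
  proof -
    have le: "D' u v \<le> D u v + e" if "u \<in> ?K" "v \<in> ?K" for u v
      using close that by (smt (verit))
    have step: "D' (p i) (p (Suc i)) \<le> D (p i) (p (Suc i)) + e" if "i < m" for i
      using that by (intro le) auto
    have "(\<Sum>i<m. D' (p i) (p (Suc i))) \<le> (\<Sum>i<m. D (p i) (p (Suc i)) + e)"
      using step by (intro sum_mono) auto
    moreover have "D' x (p 0) \<le> D x (p 0) + e" "D' (p m) y \<le> D (p m) y + e" by (intro le; simp)+
    ultimately show ?thesis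
      unfolding near_chain_def using mp(1) e le_less_trans[OF step e(4)]
      by (intro exI[of _ m] exI[of _ p]) auto
  qed
  then show "\<exists>K \<epsilon>. compact K \<and> 0 < \<epsilon> \<and>
      (\<forall>D'\<in>continuous_pseudometrics. (\<forall>x\<in>K. \<forall>y\<in>K. \<bar>D' x y - D x y\<bar> < \<epsilon>) \<longrightarrow>
         D' \<in> {D \<in> continuous_pseudometrics. near_chain D Y x y \<delta> L})"
    using \<open>0 < e\<close> by (intro exI[of _ ?K] exI[of _ e]) (auto intro: finite_imp_compact)
qed

lemma internal_metric_gt_sets:
  fixes Y :: "'b::metric_space set"
  assumes Y: "compact Y" "x \<in> Y" "y \<in> Y" and "0 \<le> L"
  shows "{D \<in> continuous_pseudometrics. ennreal L < internal_metric D Y x y} \<in> sets pseudometric_space"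
proof -
  let ?N = "\<lambda>k. {D \<in> continuous_pseudometrics. near_chain D Y x y (1 / (1 + real k)) L}"
  have "{D \<in> continuous_pseudometrics. ennreal L < internal_metric D Y x y} =
      (\<Union>k. space pseudometric_space - ?N k)"
  proof (intro equalityI subsetI; clarsimp)
    fix D :: "'b \<Rightarrow> 'b \<Rightarrow> real"
    assume D: "D \<in> continuous_pseudometrics" "ennreal L < internal_metric D Y x y"
    then have pD: "pseudometric D" by (simp add: continuous_pseudometrics_def)
    obtain \<delta> where "0 < \<delta>" and \<delta>: "\<not> near_chain D Y x y \<delta> L"
      using internal_metric_le_of_near_chains[OF D(1) Y \<open>0 \<le> L\<close>] D(2) by (meson leD)
    obtain k :: nat where "1 / real (Suc k) < \<delta>"
      using \<open>0 < \<delta>\<close> nat_approx_posE by metis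
    then have k: "1 / (1 + real k) < \<delta>" by simp
    have "\<not> near_chain D Y x y (1 / (1 + real k)) L"
      using near_chain_move_ends[OF pD, of Y x y "1 / (1 + real k)" L x "\<delta> - 1 / (1 + real k)" y L \<delta>]
        \<delta> k pseudometric_facts(2)[OF pD] by auto
    then show "\<exists>k. \<not> near_chain D Y x y (1 / (1 + real k)) L" by blast
  next
    fix D :: "'b \<Rightarrow> 'b \<Rightarrow> real" and k
    assume "D \<in> continuous_pseudometrics" "\<not> near_chain D Y x y (1 / (1 + real k)) L"
    then show "ennreal L < internal_metric D Y x y"
      using near_chain_of_internal_metric_le[of D "1 / (1 + real k)" L Y x y] \<open>0 \<le> L\<close>
      by (force simp: continuous_pseudometrics_def)
  qed
  also have "\<dots> \<in> sets pseudometric_space"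
    by (intro sets.countable_UN image_subsetI sets.compl_sets openin_sets_pseudometric_space openin_near_chain)
  finally show ?thesis .
qed

text \<open>Lower semicontinuity of the internal metric and continuity of \<open>h\<close> make the inequality an open
  condition on \<open>(x, y)\<close>, so a countable dense set of points detects it. The open set \<open>W\<close> is there to
  exclude the diagonal, where the denominator in the theorem degenerates.\<close>

lemma exists_internal_metric_gt_sets:
  fixes Y :: "'b::{metric_space, second_countable_topology} set" and h :: "'b \<times> 'b \<Rightarrow> real"
  assumes Y: "compact Y" and W: "open W" and h: "continuous_on W h" "\<And>z. z \<in> W \<Longrightarrow> 0 \<le> h z"
  shows "{D \<in> continuous_pseudometrics. \<exists>x\<in>Y. \<exists>y\<in>Y. (x, y) \<in> W \<and>
    ennreal (h (x, y)) < internal_metric D Y x y} \<in> sets pseudometric_space"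
proof -
  obtain T where T: "countable T" "T \<subseteq> Y" "Y \<subseteq> closure T"
    using separable[of Y] by blast
  let ?B = "\<lambda>(x, y). {D \<in> continuous_pseudometrics. ennreal (h (x, y)) < internal_metric D Y x y}"
  have dense: "\<exists>x'\<in>T. \<exists>y'\<in>T. (x', y') \<in> W \<and> ennreal (h (x', y')) < internal_metric D Y x' y'"
    if D: "D \<in> continuous_pseudometrics" and xy: "x \<in> Y" "y \<in> Y" "(x, y) \<in> W"
      and gt: "ennreal (h (x, y)) < internal_metric D Y x y" for D x y
  proof -
    obtain \<epsilon> where "0 < \<epsilon>" and \<epsilon>: "\<And>x' y'. D x x' < \<epsilon> \<Longrightarrow> D y y' < \<epsilon> \<Longrightarrow>
        ennreal (h (x, y) + \<epsilon>) < internal_metric D Y x' y'"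
      using internal_metric_lower_semicontinuous[OF D Y xy(1,2) h(2)[OF xy(3)] gt] by metis
    have pD: "pseudometric D"
      using D by (auto simp: continuous_pseudometrics_def)
    have nearD: "\<forall>\<^sub>F u in nhds v. D v u < \<epsilon>" for v
    proof -
      have "continuous_on UNIV (\<lambda>u. D v u)"
        by (intro continuous_on_pseudometric[OF D] continuous_intros)
      then have "((\<lambda>u. D v u) \<longlongrightarrow> D v v) (nhds v)"
        by (simp add: continuous_on_def tendsto_at_iff_tendsto_nhds)
      then show ?thesis using \<open>0 < \<epsilon>\<close> pseudometric_facts(2)[OF pD] by (intro order_tendstoD(2)) auto
    qed
    have "(h \<longlongrightarrow> h (x, y)) (nhds (x, y))"
      using h(1) W xy(3) by (metis continuous_on_eq_continuous_at continuous_at tendsto_at_iff_tendsto_nhds)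
    then have "\<forall>\<^sub>F z in nhds (x, y). h z < h (x, y) + \<epsilon>"
      using \<open>0 < \<epsilon>\<close> by (intro order_tendstoD(2)) auto
    moreover have "\<forall>\<^sub>F z in nhds (x, y). z \<in> W"
      using W xy(3) by (rule eventually_nhds_in_open)
    ultimately have "\<forall>\<^sub>F z in nhds x \<times>\<^sub>F nhds y. z \<in> W \<and> h z < h (x, y) + \<epsilon>"
      unfolding nhds_prod[symmetric] by eventually_elim simp
    then obtain P Q where PQ: "\<forall>\<^sub>F u in nhds x. P u" "\<forall>\<^sub>F u in nhds y. Q u"
      "\<And>u v. P u \<Longrightarrow> Q v \<Longrightarrow> (u, v) \<in> W \<and> h (u, v) < h (x, y) + \<epsilon>"
      unfolding eventually_prod_filter by blast
    have meet: "\<exists>u\<in>T. R u" if "v \<in> Y" "\<forall>\<^sub>F u in nhds v. R u" for v R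
    proof -
      obtain S where S: "open S" "v \<in> S" "\<And>u. u \<in> S \<Longrightarrow> R u"
        using \<open>\<forall>\<^sub>F u in nhds v. R u\<close> unfolding eventually_nhds by blast
      then have "T \<inter> S \<noteq> {}" using T(3) \<open>v \<in> Y\<close> by (meson closure_iff_nhds_not_empty subset_eq)
      then show ?thesis using S by blast
    qed
    obtain u where u: "u \<in> T" "P u" "D x u < \<epsilon>"
      using meet[OF xy(1) eventually_conj[OF PQ(1) nearD[of x]]] by blast
    obtain v where v: "v \<in> T" "Q v" "D y v < \<epsilon>"
      using meet[OF xy(2) eventually_conj[OF PQ(2) nearD[of y]]] by blast
    have "ennreal (h (u, v)) \<le> ennreal (h (x, y) + \<epsilon>)"
      using PQ(3)[OF u(2) v(2)] by (intro ennreal_leI) simp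
    then show ?thesis using u v PQ(3)[OF u(2) v(2)] \<epsilon>[OF u(3) v(3)] by (meson le_less_trans)
  qed
  have "{D \<in> continuous_pseudometrics. \<exists>x\<in>Y. \<exists>y\<in>Y. (x, y) \<in> W \<and>
      ennreal (h (x, y)) < internal_metric D Y x y} = (\<Union>z \<in> (T \<times> T) \<inter> W. ?B z)"
    using T(2) dense by (auto simp: subset_eq) blast
  also have "\<dots> \<in> sets pseudometric_space"
    using T(1,2) Y h(2)
    by (intro sets.countable_UN') (auto intro!: internal_metric_gt_sets countable_Int1 countable_SIGMA)
  finally show ?thesis .
qed

lemma diam_gt_sets:
  fixes Y :: "'b::{metric_space, second_countable_topology} set"
  assumes "compact Y" "0 \<le> c"
  shows "{D \<in> continuous_pseudometrics. ennreal c < diam D Y} \<in> sets pseudometric_space"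
  using exists_internal_metric_gt_sets[of Y UNIV "\<lambda>_. c"] assms
  by (simp add: diam_def less_SUP_iff)

lemma dist_to_set_measurable:
  fixes x :: "'b::metric_space"
  shows "(\<lambda>D. dist_to_set D x U) \<in> borel_measurable pseudometric_space"
proof (rule borel_measurableI_less)
  fix c :: ennreal
  have "openin local_uniform_topology {D \<in> continuous_pseudometrics. dist_to_set D x U < c}"
  proof (rule openin_local_uniformI; clarify?)
    fix D :: "'b \<Rightarrow> 'b \<Rightarrow> real"
    assume "D \<in> continuous_pseudometrics" and less: "dist_to_set D x U < c"
    then have pD: "pseudometric D" by (simp add: continuous_pseudometrics_def)
    obtain y where y: "y \<in> U" "ennreal (D x y) < c"
      using less by (auto simp: dist_to_set_def INF_less_iff)
    have "((\<lambda>e. ennreal (D x y + e)) \<longlongrightarrow> ennreal (D x y + 0)) (at_right 0)"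
      by (intro tendsto_intros)
    then have "\<forall>\<^sub>F e in at_right 0. ennreal (D x y + e) < c"
      using y(2) by (intro order_tendstoD(2)) auto
    then have "\<forall>\<^sub>F e in at_right 0. 0 < e \<and> ennreal (D x y + e) < c"
      using eventually_at_right_less[of "0::real"] by eventually_elim simp
    then obtain e where e: "0 < e" "ennreal (D x y + e) < c"
      using eventually_happens'[OF trivial_limit_at_right_real] by blast
    have "dist_to_set D' x U < c" if "\<bar>D' x y - D x y\<bar> < e" for D'
    proof -
      have "dist_to_set D' x U \<le> ennreal (D x y + e)"
        unfolding dist_to_set_def using y(1) that by (intro INF_lower2[of y] ennreal_leI) auto
      then show ?thesis using e(2) by simp
    qed
    then show "\<exists>K \<epsilon>. compact K \<and> 0 < \<epsilon> \<and>
      (\<forall>D'\<in>continuous_pseudometrics. (\<forall>x\<in>K. \<forall>y\<in>K. \<bar>D' x y - D x y\<bar> < \<epsilon>) \<longrightarrow>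
         D' \<in> {D \<in> continuous_pseudometrics. dist_to_set D x U < c})"
      using e(1) by (intro exI[of _ "{x, y}"] exI[of _ e]) auto
  qed
  then show "{D \<in> space pseudometric_space. dist_to_set D x U < c} \<in> sets pseudometric_space"
    by (simp add: openin_sets_pseudometric_space)
qed

definition shift :: "'b::ab_group_add \<Rightarrow> ('b \<Rightarrow> 'b \<Rightarrow> real) \<Rightarrow> 'b \<Rightarrow> 'b \<Rightarrow> real" where
  "shift z D x y = D (x + z) (y + z)"

lemma shift_continuous_pseudometrics:
  fixes z :: "'b::real_normed_vector"
  assumes "D \<in> continuous_pseudometrics"
  shows "shift z D \<in> continuous_pseudometrics"
proof -
  have pD: "pseudometric D"
    using assms by (auto simp: continuous_pseudometrics_def)
  have "continuous_on UNIV (\<lambda>p. D (fst p + z) (snd p + z))"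
    by (intro continuous_on_pseudometric[OF assms] continuous_intros)
  then show ?thesis
    using pD by (auto simp: continuous_pseudometrics_def shift_def pseudometric_def case_prod_beta)
qed

text \<open>The preimage of a basic neighbourhood on \<open>K\<close> under the shift is one on \<open>z + K\<close>.\<close>

lemma shift_measurable [measurable]:
  fixes z :: "'b::real_normed_vector"
  shows "shift z \<in> measurable pseudometric_space pseudometric_space"
proof -
  have cont: "continuous_map local_uniform_topology local_uniform_topology (shift z)"
    unfolding local_uniform_topology_def[where 'b='b]
  proof (rule continuous_on_generated_topo, fold local_uniform_topology_def)
    fix U assume "U \<in> {{D' \<in> continuous_pseudometrics. \<forall>x\<in>K. \<forall>y\<in>K. \<bar>D' x y - D x y\<bar> < \<epsilon>} | D K \<epsilon>.
        (D :: 'b \<Rightarrow> 'b \<Rightarrow> real) \<in> continuous_pseudometrics \<and> compact K \<and> 0 < \<epsilon>}"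
    then obtain D K \<epsilon> where U: "U = {D' \<in> continuous_pseudometrics. \<forall>x\<in>K. \<forall>y\<in>K. \<bar>D' x y - D x y\<bar> < \<epsilon>}"
      and D: "D \<in> continuous_pseudometrics" "compact K" "0 < \<epsilon>" by blast
    have "shift z -` U \<inter> topspace local_uniform_topology =
      {D' \<in> continuous_pseudometrics. \<forall>x\<in>(+) z ` K. \<forall>y\<in>(+) z ` K. \<bar>D' x y - shift (- z) D x y\<bar> < \<epsilon>}"
      unfolding topspace_local_uniform_topology U
      using shift_continuous_pseudometrics by (auto simp: shift_def add.commute)
    also have "openin local_uniform_topology \<dots>"
      unfolding local_uniform_topology_def
      using D shift_continuous_pseudometrics compact_translation[of K z]
      by (intro topology_generated_by_Basis) blast
    finally show "openin local_uniform_topology (shift z -` U \<inter> topspace local_uniform_topology)" .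
  next
    show "shift z ` topspace local_uniform_topology \<subseteq> \<Union> {{D' \<in> continuous_pseudometrics. \<forall>x\<in>K. \<forall>y\<in>K. \<bar>D' x y - D x y\<bar> < \<epsilon>} | D K \<epsilon>.
        (D :: 'b \<Rightarrow> 'b \<Rightarrow> real) \<in> continuous_pseudometrics \<and> compact K \<and> 0 < \<epsilon>}"
      using topspace_local_uniform_topology[where 'a='b] shift_continuous_pseudometrics
      unfolding local_uniform_topology_def topology_generated_by_topspace by auto
  qed
  show ?thesis
    unfolding pseudometric_space_def[where 'b='b]
  proof (rule measurable_measure_of[OF opens_subset_continuous_pseudometrics], fold pseudometric_space_def)
    fix U :: "('b \<Rightarrow> 'b \<Rightarrow> real) set" assume "U \<in> {U. openin local_uniform_topology U}"
    then have "openin local_uniform_topology {D \<in> topspace local_uniform_topology. shift z D \<in> U}"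
      using cont by (intro openin_continuous_map_preimage) auto
    then have "{D \<in> continuous_pseudometrics. shift z D \<in> U} \<in> sets pseudometric_space"
      by (simp add: topspace_local_uniform_topology openin_sets_pseudometric_space)
    then show "shift z -` U \<inter> space pseudometric_space \<in> sets pseudometric_space"
      by (simp add: vimage_def Int_def conj_commute)
  qed (auto intro: shift_continuous_pseudometrics)
qed

section \<open>Diameter tails and the uniqueness of the exponent\<close>

lemma mem_cube: "x \<in> cube a b \<longleftrightarrow> (\<forall>i. a \<le> x $ i \<and> x $ i \<le> b)"
  by (simp add: cube_def mem_box_cart)

lemma compact_cube: "compact (cube a b)"
  by (simp add: cube_def)

lemma infnorm_le_cart:
  fixes x :: "real ^ 'n"
  assumes "\<And>i. \<bar>x $ i\<bar> \<le> c"
  shows "infnorm x \<le> c"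
  unfolding infnorm_cart by (rule cSup_least) (use assms in auto)

lemma weak_LRP_metricD:
  assumes "weak_LRP_metric \<beta> P \<theta> D"
  shows "prob_space P" "D \<in> measurable P pseudometric_space" "0 < \<theta>"
    "exponential_moment_axiom P \<theta> D" "tightness_axiom P \<theta> D" "law P (\<lambda>\<xi>. shift z (D \<xi>)) = law P D"
proof -
  have "sets P = sets edge_space" using assms by (simp add: weak_LRP_metric_def poisson_edge_law_def)
  then show "D \<in> measurable P pseudometric_space"
    using assms by (simp add: weak_LRP_metric_def cong: measurable_cong_sets)
  have "shift z (D \<xi>) = (\<lambda>x y. D \<xi> (x + z) (y + z))" for \<xi> by (simp add: shift_def fun_eq_iff)
  then show "law P (\<lambda>\<xi>. shift z (D \<xi>)) = law P D"
    using assms by (simp add: weak_LRP_metric_def translation_invariance_axiom_def)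
qed (use assms in \<open>auto simp: weak_LRP_metric_def poisson_edge_law_def\<close>)

lemma measure_law:
  assumes "D \<in> measurable P pseudometric_space" "A \<in> sets pseudometric_space"
  shows "measure (law P D) A = measure P {\<xi> \<in> space P. D \<xi> \<in> A}"
  unfolding law_def measure_distr[OF assms] by (simp add: vimage_def Int_def conj_commute)

lemma linear_le_powr:
  fixes a t :: real
  assumes "0 < \<theta>" "0 \<le> a" "0 \<le> t"
  shows "a * t \<le> t powr (1 + \<theta>) + a powr (1 + 1 / \<theta>)"
proof (cases "a \<le> t powr \<theta>")
  case True
  then have "a * t \<le> t powr \<theta> * t" using \<open>0 \<le> t\<close> by (intro mult_right_mono)
  also have "\<dots> = t powr (1 + \<theta>)" using \<open>0 \<le> t\<close> by (simp add: powr_add mult.commute)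
  finally show ?thesis by (simp add: add_increasing2)
next
  case False
  then have "(t powr \<theta>) powr (1 / \<theta>) \<le> a powr (1 / \<theta>)" using assms by (intro powr_mono2) auto
  then have "t \<le> a powr (1 / \<theta>)" using assms by (simp add: powr_powr)
  then have "a * t \<le> a * a powr (1 / \<theta>)" using \<open>0 \<le> a\<close> by (intro mult_left_mono)
  also have "\<dots> = a powr (1 + 1 / \<theta>)" using \<open>0 \<le> a\<close> by (simp add: powr_add)
  finally show ?thesis by (simp add: add_increasing)
qed

text \<open>The tail of the rescaled diameter decays at every exponential rate \<open>a\<close>, by Markov's inequality for
  the moment with exponent \<open>\<eta> = 1 + \<theta>\<close>. The bound speaks of the law only, so it can be used
  for any other metric with the same law.\<close>

lemma law_diam_tail:
  fixes P :: "((real ^ 'n) \<times> (real ^ 'n)) measure measure"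
  assumes weak: "weak_LRP_metric \<beta> P \<theta> D" and "0 \<le> a"
  shows "\<exists>c>0. \<forall>r>0. \<forall>t\<ge>0.
    measure (law P D) {D' \<in> continuous_pseudometrics. ennreal (t * r powr \<theta>) < diam D' (cube 0 r)}
      \<le> c * exp (- (a * t))"
proof -
  note W = weak_LRP_metricD[OF weak]
  interpret prob_space P by (rule W)
  define I where "I r \<xi> = (if diam (D \<xi>) (cube 0 r) = \<top> then \<top>
      else ennreal (exp ((enn2real (diam (D \<xi>) (cube 0 r)) / r powr \<theta>) powr (1 + \<theta>))))" for r \<xi>
  define S where "S = (SUP r \<in> {0<..}. \<integral>\<^sup>+\<xi>. I r \<xi> \<partial>P)"
  \<comment> \<open>The exponent \<open>1 + \<theta>\<close> exceeds 1 and is always admissible, as \<open>(1 + \<theta>) (1 - \<theta>) < 1\<close>.\<close>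
  have "\<theta> < 1 \<longrightarrow> 1 + \<theta> < 1 / (1 - \<theta>)"
  proof
    assume "\<theta> < 1"
    moreover have "(1 + \<theta>) * (1 - \<theta>) < 1" using \<open>0 < \<theta>\<close> by (simp add: algebra_simps)
    ultimately show "1 + \<theta> < 1 / (1 - \<theta>)" by (simp add: pos_less_divide_eq)
  qed
  then have S: "S < \<top>"
    using W(3,4) unfolding exponential_moment_axiom_def S_def I_def by simp
  define c where "c = (enn2real S + 1) * exp (a powr (1 + 1 / \<theta>))"
  have "0 < c" by (simp add: c_def add_nonneg_pos)
  moreover have "\<forall>r>0. \<forall>t\<ge>0.
    measure (law P D) {D' \<in> continuous_pseudometrics. ennreal (t * r powr \<theta>) < diam D' (cube 0 r)}
      \<le> c * exp (- (a * t))"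
  proof (intro allI impI)
    fix r t :: real assume "0 < r" "0 \<le> t"
    let ?A = "{D' \<in> continuous_pseudometrics. ennreal (t * r powr \<theta>) < diam D' (cube 0 r :: (real ^ 'n) set)}"
    let ?B = "{\<xi> \<in> space P. D \<xi> \<in> ?A}"
    have A: "?A \<in> sets pseudometric_space"
      using \<open>0 \<le> t\<close> by (intro diam_gt_sets compact_cube) simp
    have B: "?B \<in> sets P"
      using measurable_sets[OF W(2) A] by (simp add: vimage_def Int_def conj_commute)
    have "ennreal (exp (t powr (1 + \<theta>))) * emeasure P ?B
        = (\<integral>\<^sup>+\<xi>. ennreal (exp (t powr (1 + \<theta>))) * indicator ?B \<xi> \<partial>P)"
      by (rule nn_integral_cmult_indicator[OF B, symmetric])
    also have "\<dots> \<le> (\<integral>\<^sup>+\<xi>. I r \<xi> \<partial>P)"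
    proof (rule nn_integral_mono)
      fix \<xi> assume "\<xi> \<in> space P"
      show "ennreal (exp (t powr (1 + \<theta>))) * indicator ?B \<xi> \<le> I r \<xi>"
      proof (cases "\<xi> \<in> ?B")
        case True
        then have gt: "ennreal (t * r powr \<theta>) < diam (D \<xi>) (cube 0 r)" by simp
        show ?thesis
        proof (cases "diam (D \<xi>) (cube 0 r)")
          case (real d)
          then have "t * r powr \<theta> < d" using gt \<open>0 \<le> t\<close> by (simp add: ennreal_less_iff)
          then have "t \<le> d / r powr \<theta>" using \<open>0 < r\<close> by (simp add: pos_le_divide_eq)
          then have "t powr (1 + \<theta>) \<le> (d / r powr \<theta>) powr (1 + \<theta>)"
            using \<open>0 \<le> t\<close> W(3) by (intro powr_mono2) auto
          then show ?thesis using True real by (simp add: I_def ennreal_leI)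
        qed (simp add: I_def)
      qed simp
    qed
    also have "\<dots> \<le> S" unfolding S_def using \<open>0 < r\<close> by (intro SUP_upper) simp
    also have "S = ennreal (enn2real S)" using S by simp
    finally have "exp (t powr (1 + \<theta>)) * prob ?B \<le> enn2real S"
      by (simp add: emeasure_eq_measure flip: ennreal_mult)
    then have "prob ?B \<le> enn2real S * exp (- (t powr (1 + \<theta>)))"
      by (simp add: exp_minus field_simps)
    also have "\<dots> \<le> (enn2real S + 1) * exp (a powr (1 + 1 / \<theta>) - a * t)"
      using linear_le_powr[OF W(3) \<open>0 \<le> a\<close> \<open>0 \<le> t\<close>] by (intro mult_mono) auto
    also have "\<dots> = c * exp (- (a * t))" by (simp add: c_def exp_diff exp_minus field_simps)
    finally show "measure (law P D) ?A \<le> c * exp (- (a * t))"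
      by (simp add: measure_law[OF W(2) A])
  qed
  ultimately show ?thesis by blast
qed

lemma ennreal_inverse_le_mono: "a \<le> b \<Longrightarrow> inverse b \<le> inverse (a :: ennreal)"
  including ennreal.lifting
  by transfer (rule ereal_inverse_antimono)

lemma dist_to_set_le_diam_cube:
  fixes D :: "real ^ 'n \<Rightarrow> real ^ 'n \<Rightarrow> real"
  assumes "0 < r"
  shows "dist_to_set D 0 (- cube (- r) r) \<le> diam D (cube 0 (2 * r))"
proof -
  let ?p = "(\<chi> i. 2 * r) :: real ^ 'n"
  have "dist_to_set D 0 (- cube (- r) r) \<le> ennreal (D 0 ?p)"
    unfolding dist_to_set_def using assms by (intro INF_lower) (simp add: mem_cube)
  also have "\<dots> \<le> internal_metric D (cube 0 (2 * r)) 0 ?p"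
    by (rule dist_le_internal_metric)
  also have "\<dots> \<le> diam D (cube 0 (2 * r))"
    using assms by (intro internal_metric_le_diam) (simp_all add: mem_cube)
  finally show ?thesis .
qed

text \<open>Otherwise \<open>\<theta> < \<theta>'\<close>. The moments for \<open>\<theta>\<close> make the distance from \<open>0\<close> to the complement of
  \<open>[-r, r]\<^sup>d\<close> at most of order \<open>r\<^sup>\<theta>\<close> with probability above 1/2, uniformly in \<open>r\<close>, whereas tightness
  for \<open>\<theta>'\<close> makes it at least of order \<open>r powr \<theta>'\<close> with probability at least 1/2. These two events
  exclude each other for a suitable large \<open>r\<close>.\<close>

lemma exponent_le_of_same_law:
  fixes P P' :: "((real ^ 'n) \<times> (real ^ 'n)) measure measure"
  assumes weak: "weak_LRP_metric \<beta> P \<theta> D" "weak_LRP_metric \<beta>' P' \<theta>' D'"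
    and law: "law P D = law P' D'"
  shows "\<theta>' \<le> \<theta>"
proof (rule ccontr)
  assume "\<not> \<theta>' \<le> \<theta>"
  then have less: "\<theta> < \<theta>'" by simp
  note W = weak_LRP_metricD[OF weak(2)]
  interpret prob_space P' by (rule W)
  obtain c where c: "0 < c" "\<And>r t. 0 < r \<Longrightarrow> 0 \<le> t \<Longrightarrow> measure (law P D)
      {D \<in> continuous_pseudometrics. ennreal (t * r powr \<theta>) < diam D (cube 0 r :: (real ^ 'n) set)}
      \<le> c * exp (- (1 * t))"
    using law_diam_tail[OF weak(1) zero_le_one] by blast
  obtain K :: real where K: "\<And>r. 0 < r \<Longrightarrow> prob {\<xi> \<in> space P'.
          ennreal (r powr \<theta>') / dist_to_set (D' \<xi>) 0 (- cube (- r) r) > ennreal K} \<le> 1 / 2"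
    using W(5)[unfolded tightness_axiom_def, THEN spec[of _ "1 / 2"]] by auto
  \<comment> \<open>\<open>t\<close> makes the tail smaller than 1/2; \<open>r\<close> is chosen so that \<open>r\<^bsup>\<theta>'\<^esup>\<close> is \<open>\<bar>K\<bar> + 1\<close> times the bound \<open>s\<close> on the diameter.\<close>
  define t where "t = 2 * c"
  define q where "q = (\<bar>K\<bar> + 1) * (t * 2 powr \<theta>)"
  define r where "r = q powr (1 / (\<theta>' - \<theta>))"
  define s where "s = t * (2 * r) powr \<theta>"
  have pos: "0 < t" "0 < q" "0 < r" "0 < s"
    using c(1) by (simp_all add: t_def q_def r_def s_def)
  have "r powr (\<theta>' - \<theta>) = q" using less pos by (simp add: r_def powr_powr)
  then have "r powr \<theta>' = q * r powr \<theta>"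
    using pos by (simp add: powr_diff field_simps)
  also have "\<dots> = (\<bar>K\<bar> + 1) * s"
    using pos by (simp add: q_def s_def powr_mult)
  finally have ratio: "r powr \<theta>' / s = \<bar>K\<bar> + 1" using pos by simp
  have tail: "c * exp (- t) < 1 / 2"
  proof -
    have "2 * c < exp t" using exp_ge_add_one_self[of t] unfolding t_def by linarith
    then show ?thesis by (simp add: exp_minus field_simps)
  qed
  let ?A = "{D \<in> continuous_pseudometrics. ennreal s < diam D (cube 0 (2 * r) :: (real ^ 'n) set)}"
  let ?E = "{\<xi> \<in> space P'. ennreal (r powr \<theta>') / dist_to_set (D' \<xi>) 0 (- cube (- r) r) > ennreal K}"
  have A: "?A \<in> sets pseudometric_space" using pos by (intro diam_gt_sets compact_cube) simp
  have "prob {\<xi> \<in> space P'. D' \<xi> \<in> ?A} < 1 / 2"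
    using c(2)[of "2 * r" t] pos tail law measure_law[OF W(2) A] by (simp add: s_def)
  moreover have ev: "{\<xi> \<in> space P'. D' \<xi> \<in> ?A} \<in> events"
    using measurable_sets[OF W(2) A] by (simp add: vimage_def Int_def conj_commute)
  ultimately have "1 / 2 < prob (space P' - {\<xi> \<in> space P'. D' \<xi> \<in> ?A})"
    by (simp add: prob_compl)
  also have "\<dots> \<le> prob ?E"
  proof (rule finite_measure_mono)
    have [measurable]: "(\<lambda>\<xi>. dist_to_set (D' \<xi>) 0 (- cube (- r) r)) \<in> borel_measurable P'"
      using measurable_compose[OF W(2) dist_to_set_measurable] by simp
    show "?E \<in> events" by measurable
    show "space P' - {\<xi> \<in> space P'. D' \<xi> \<in> ?A} \<subseteq> ?E"
    proof clarsimp
      fix \<xi> assume \<xi>: "\<xi> \<in> space P'" "D' \<xi> \<in> continuous_pseudometrics \<longrightarrow> \<not> ennreal s < diam (D' \<xi>) (cube 0 (2 * r))"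
      have "D' \<xi> \<in> continuous_pseudometrics" using measurable_space[OF W(2) \<xi>(1)] by simp
      then have "diam (D' \<xi>) (cube 0 (2 * r)) \<le> ennreal s" using \<xi>(2) by (simp add: not_less)
      then have le: "dist_to_set (D' \<xi>) 0 (- cube (- r) r) \<le> ennreal s"
        using dist_to_set_le_diam_cube[OF pos(3), of "D' \<xi>"] by (rule order_trans[rotated])
      have "ennreal K < ennreal (\<bar>K\<bar> + 1)" by (rule ennreal_lessI) auto
      also have "\<dots> = ennreal (r powr \<theta>') / ennreal s" using pos by (simp add: divide_ennreal ratio)
      also have "\<dots> \<le> ennreal (r powr \<theta>') / dist_to_set (D' \<xi>) 0 (- cube (- r) r)"
        unfolding divide_ennreal_def using le by (intro mult_left_mono ennreal_inverse_le_mono) auto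
      finally show "ennreal K < ennreal (r powr \<theta>') / dist_to_set (D' \<xi>) 0 (- cube (- r) r)" .
    qed
  qed
  also have "\<dots> \<le> 1 / 2" by (rule K[OF pos(3)])
  finally show False by simp
qed

section \<open>Half-overlapping subcubes\<close>

text \<open>The intervals \<open>[k m, (k + 2) m]\<close> overlap by half their length, so two points at distance at most
  \<open>m\<close> share one of them: the one that starts at the grid point just below the smaller point, or the
  last one if that would stick out. For \<open>N = 1\<close> the only interval is everything.\<close>

lemma half_overlapping_intervals:
  fixes u v m :: real and N :: nat
  assumes "0 < m" "1 \<le> N" "0 \<le> u" "u \<le> 2 * real N * m" "0 \<le> v" "v \<le> 2 * real N * m"
    and close: "N = 1 \<or> \<bar>u - v\<bar> \<le> m"
  shows "\<exists>k::nat. k + 2 \<le> 2 * N \<and> k * m \<le> u \<and> u \<le> k * m + 2 * m \<and> k * m \<le> v \<and> v \<le> k * m + 2 * m"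
proof (cases "N = 1")
  case True
  then show ?thesis using assms by (intro exI[of _ 0]) auto
next
  case False
  define w where "w = min u v"
  define j where "j = nat \<lfloor>w / m\<rfloor>"
  have "0 \<le> w / m" using assms by (simp add: w_def)
  then have "real j \<le> w / m" "w / m < real j + 1" unfolding j_def by linarith+
  then have j: "j * m \<le> w" "w < j * m + m" using \<open>0 < m\<close> by (simp_all add: field_simps)
  have close': "\<bar>u - v\<bar> \<le> m" using close False by simp
  show ?thesis
  proof (cases "j + 2 \<le> 2 * N")
    case True
    then show ?thesis using j close' by (intro exI[of _ j]) (auto simp: w_def)
  next
    case large: False
    define k where "k = 2 * N - 2"
    have k: "real k = 2 * real N - 2" "k \<le> j" using large \<open>1 \<le> N\<close> by (auto simp: k_def of_nat_diff)
    then have "k * m \<le> j * m" using \<open>0 < m\<close> by (intro mult_right_mono) auto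
    then have "k * m \<le> w" using j by linarith
    moreover have "k * m + 2 * m = (real k + 2) * m" by (simp add: distrib_right)
    then have "k * m + 2 * m = 2 * real N * m" using k(1) by simp
    ultimately show ?thesis
      using assms \<open>1 \<le> N\<close> by (intro exI[of _ k]) (auto simp: w_def k_def)
  qed
qed

text \<open>For \<open>\<delta> > R\<close> the scale is \<open>n = 0\<close>; the subcube is then the whole cube and contains any two points.\<close>

lemma dyadic_scale:
  fixes R \<delta> :: real
  assumes "0 < \<delta>"
  shows "\<exists>n. R < 2 ^ (n + 1) * \<delta> \<and> (n = 0 \<or> 2 ^ n * \<delta> \<le> R)"
proof -
  \<comment> \<open>With \<open>m\<close> minimal, take \<open>n = m - 1\<close>, truncated at 0.\<close>
  define m where "m = (LEAST m. R < 2 ^ m * \<delta>)"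
  have "\<exists>m. R / \<delta> < 2 ^ m" by (rule real_arch_pow) simp
  then have ex: "\<exists>m. R < 2 ^ m * \<delta>" using assms by (simp add: field_simps)
  have m: "R < 2 ^ m * \<delta>" unfolding m_def using LeastI_ex[OF ex] .
  show ?thesis
  proof (cases m)
    case 0
    then show ?thesis using m assms by (intro exI[of _ 0]) auto
  next
    case (Suc n)
    then have "2 ^ n * \<delta> \<le> R" using not_less_Least[of n "\<lambda>m. R < 2 ^ m * \<delta>"] by (simp add: m_def)
    then show ?thesis using m Suc by auto
  qed
qed

text \<open>The lowest corner of the subcube of side \<open>2R / 2\<^sup>n\<close> with index \<open>k\<close>; the mesh of the grid is half
  this side.\<close>

definition corner :: "real \<Rightarrow> nat \<Rightarrow> ('n \<Rightarrow> nat) \<Rightarrow> real ^ 'n" where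
  "corner R n k = (\<chi> i. - R + real (k i) * (R / 2 ^ n))"

lemma mem_shifted_cube:
  "x \<in> (\<lambda>v. v + corner R n k) ` cube 0 s \<longleftrightarrow>
    (\<forall>i. corner R n k $ i \<le> x $ i \<and> x $ i \<le> corner R n k $ i + s)"
proof -
  have "x \<in> (\<lambda>v. v + corner R n k) ` cube 0 s \<longleftrightarrow> x - corner R n k \<in> cube 0 s"
    by (metis (no_types, lifting) add_diff_cancel diff_add_cancel image_iff)
  then show ?thesis by (auto simp: mem_cube algebra_simps)
qed

lemma common_subcube:
  fixes x x' :: "real ^ 'n"
  assumes "0 < R" and x: "x \<in> cube (- R) R" "x' \<in> cube (- R) R" and "x \<noteq> x'"
  obtains n k where "\<And>i. k i < 2 ^ (n + 1)"
    "(\<lambda>v. v + corner R n k) ` cube 0 (2 * R / 2 ^ n) \<subseteq> cube (- R) R"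
    "x \<in> (\<lambda>v. v + corner R n k) ` cube 0 (2 * R / 2 ^ n)"
    "x' \<in> (\<lambda>v. v + corner R n k) ` cube 0 (2 * R / 2 ^ n)"
    "2 * R / 2 ^ n \<le> 4 * infnorm (x - x')" "real (n + 1) * ln 2 \<le> ln (4 * R / infnorm (x - x'))"
proof -
  define \<delta> where "\<delta> = infnorm (x - x')"
  have "0 < \<delta>" using \<open>x \<noteq> x'\<close> by (simp add: \<delta>_def infnorm_pos_lt)
  have "\<delta> \<le> 2 * R"
    unfolding \<delta>_def
  proof (rule infnorm_le_cart)
    fix i show "\<bar>(x - x') $ i\<bar> \<le> 2 * R"
      using x[unfolded mem_cube, THEN spec[of _ i]] by (simp add: abs_le_iff)
  qed
  obtain n where n: "R < 2 ^ (n + 1) * \<delta>" "n = 0 \<or> 2 ^ n * \<delta> \<le> R"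
    using dyadic_scale[OF \<open>0 < \<delta>\<close>] by blast
  define m where "m = R / 2 ^ n"
  have m: "0 < m" "2 * real (2 ^ n) * m = 2 * R" using \<open>0 < R\<close> by (simp_all add: m_def)
  have "\<exists>k. k + 2 \<le> 2 * (2 ^ n :: nat) \<and> k * m \<le> x $ i + R \<and> x $ i + R \<le> k * m + 2 * m \<and>
      k * m \<le> x' $ i + R \<and> x' $ i + R \<le> k * m + 2 * m" for i
  proof (rule half_overlapping_intervals[OF m(1), where N = "2 ^ n"])
    have "- R \<le> x $ i" "x $ i \<le> R" "- R \<le> x' $ i" "x' $ i \<le> R"
      using x by (simp_all add: mem_cube minus_le_iff)
    then show "0 \<le> x $ i + R" "x $ i + R \<le> 2 * real (2 ^ n) * m"
      "0 \<le> x' $ i + R" "x' $ i + R \<le> 2 * real (2 ^ n) * m"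
      using m(2) by linarith+
    have "\<bar>x $ i - x' $ i\<bar> \<le> \<delta>" using component_le_infnorm_cart[of "x - x'" i] by (simp add: \<delta>_def)
    moreover have "n = 0 \<or> \<delta> \<le> m" using n(2) by (auto simp: m_def field_simps)
    ultimately show "2 ^ n = (1::nat) \<or> \<bar>x $ i + R - (x' $ i + R)\<bar> \<le> m" by auto
  qed simp
  then obtain k :: "'n \<Rightarrow> nat" where k: "\<And>i. k i + 2 \<le> 2 * 2 ^ n" "\<And>i. k i * m \<le> x $ i + R"
      "\<And>i. x $ i + R \<le> k i * m + 2 * m" "\<And>i. k i * m \<le> x' $ i + R" "\<And>i. x' $ i + R \<le> k i * m + 2 * m"
    by metis
  have cor: "corner R n k $ i = - R + k i * m" for i by (simp add: corner_def m_def)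
  have side: "2 * R / 2 ^ n = 2 * m" by (simp add: m_def)
  show thesis
  proof (rule that[of k n])
    show "k i < 2 ^ (n + 1)" for i using k(1)[of i] by simp
    show "x \<in> (\<lambda>v. v + corner R n k) ` cube 0 (2 * R / 2 ^ n)"
      "x' \<in> (\<lambda>v. v + corner R n k) ` cube 0 (2 * R / 2 ^ n)"
      unfolding side mem_shifted_cube cor using k(2-5) by (smt (verit))+
    show "(\<lambda>v. v + corner R n k) ` cube 0 (2 * R / 2 ^ n) \<subseteq> cube (- R) R"
    proof
      fix v assume v: "v \<in> (\<lambda>v. v + corner R n k) ` cube 0 (2 * R / 2 ^ n)"
      have "- R \<le> v $ i \<and> v $ i \<le> R" for i
      proof -
        have "(real (k i) + 2) * m \<le> (2 * 2 ^ n) * m"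
          using k(1)[of i] m(1) by (intro mult_right_mono) (simp_all flip: of_nat_le_iff[where 'a=real])
        then have "real (k i) * m + 2 * m \<le> 2 * R" using m(2) by (simp add: distrib_right)
        moreover have "0 \<le> real (k i) * m" using m(1) by simp
        moreover note v[unfolded side mem_shifted_cube cor, THEN spec[of _ i]]
        ultimately show ?thesis by linarith
      qed
      then show "v \<in> cube (- R) R" by (simp add: mem_cube)
    qed
    show "2 * R / 2 ^ n \<le> 4 * infnorm (x - x')"
      using n(1) by (simp add: field_simps flip: \<delta>_def)
    have "2 ^ (n + 1) * \<delta> \<le> 4 * R"
    proof (cases "n = 0")
      case False
      then show ?thesis using n(2) \<open>0 < R\<close> by (simp add: mult.commute mult.left_commute)
    qed (use \<open>\<delta> \<le> 2 * R\<close> in simp)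
    then have "2 ^ (n + 1) \<le> 4 * R / \<delta>" using \<open>0 < \<delta>\<close> by (simp add: pos_le_divide_eq)
    then have "ln (2 ^ (n + 1)) \<le> ln (4 * R / \<delta>)" by (intro ln_mono) auto
    then show "real (n + 1) * ln 2 \<le> ln (4 * R / infnorm (x - x'))"
      using ln_realpow[of 2 "n + 1"] by (simp only: \<delta>_def)
  qed
qed

lemma ennreal_less_divide_iff:
  assumes "0 \<le> M" "0 < g"
  shows "ennreal M < I / ennreal g \<longleftrightarrow> ennreal (M * g) < I"
proof (cases I)
  case (real i)
  then show ?thesis using assms by (simp add: divide_ennreal ennreal_less_iff pos_less_divide_eq)
qed (use assms in \<open>simp add: ennreal_top_divide\<close>)

text \<open>Passing from the cube to a subcube can only increase the internal metric. The factor
  \<open>4 powr (- \<theta>)\<close> is lost because the side of the subcube may be four times the distance of the points.\<close>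

lemma large_ratio_large_subcube:
  fixes x x' :: "real ^ 'n"
  assumes "0 < R" "0 < M" "0 < \<theta>" and x: "x \<in> cube (- R) R" "x' \<in> cube (- R) R" "x \<noteq> x'"
    and gt: "ennreal (M * (infnorm (x - x') powr \<theta> * ln (4 * R / infnorm (x - x'))))
      < internal_metric D (cube (- R) R) x x'"
  shows "\<exists>n k. (\<forall>i. k i < 2 ^ (n + 1)) \<and>
    ennreal (M * 4 powr (- \<theta>) * (real (n + 1) * ln 2) * (2 * R / 2 ^ n) powr \<theta>)
      < diam (shift (corner R n k) D) (cube 0 (2 * R / 2 ^ n))"
proof -
  obtain n k where nk: "\<And>i. k i < 2 ^ (n + 1)"
    "(\<lambda>v. v + corner R n k) ` cube 0 (2 * R / 2 ^ n) \<subseteq> cube (- R) R"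
    "x \<in> (\<lambda>v. v + corner R n k) ` cube 0 (2 * R / 2 ^ n)"
    "x' \<in> (\<lambda>v. v + corner R n k) ` cube 0 (2 * R / 2 ^ n)"
    "2 * R / 2 ^ n \<le> 4 * infnorm (x - x')" "real (n + 1) * ln 2 \<le> ln (4 * R / infnorm (x - x'))"
    using common_subcube[OF \<open>0 < R\<close> x] by metis
  let ?Q = "(\<lambda>v. v + corner R n k) ` cube 0 (2 * R / 2 ^ n)"
  have "(2 * R / 2 ^ n) powr \<theta> \<le> (4 * infnorm (x - x')) powr \<theta>"
    using nk(5) assms by (intro powr_mono2) auto
  then have scale: "4 powr (- \<theta>) * (2 * R / 2 ^ n) powr \<theta> \<le> infnorm (x - x') powr \<theta>"
    by (simp add: powr_mult infnorm_pos_le powr_minus field_simps)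
  have "M * ((4 powr (- \<theta>) * (2 * R / 2 ^ n) powr \<theta>) * (real (n + 1) * ln 2))
      \<le> M * (infnorm (x - x') powr \<theta> * ln (4 * R / infnorm (x - x')))"
    using \<open>0 < M\<close> scale nk(6) by (intro mult_left_mono mult_mono) auto
  then have "ennreal (M * 4 powr (- \<theta>) * (real (n + 1) * ln 2) * (2 * R / 2 ^ n) powr \<theta>)
      \<le> ennreal (M * (infnorm (x - x') powr \<theta> * ln (4 * R / infnorm (x - x'))))"
    by (intro ennreal_leI) (simp add: mult_ac)
  also note gt
  also have "internal_metric D (cube (- R) R) x x' \<le> internal_metric D ?Q x x'"
    by (rule internal_metric_antimono[OF nk(2)])
  also have "\<dots> \<le> diam D ?Q" using nk(3,4) by (rule internal_metric_le_diam)
  also have "\<dots> \<le> diam (shift (corner R n k) D) (cube 0 (2 * R / 2 ^ n))"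
    using diam_image_le[of D "\<lambda>v. v + corner R n k" "cube 0 (2 * R / 2 ^ n)"]
    by (simp add: shift_def[abs_def])
  finally show ?thesis using nk(1) by blast
qed

section \<open>Union bound over all scales\<close>

lemma geometric_sum_bound:
  fixes \<kappa> :: real
  assumes "2 ^ d < \<kappa>"
  defines "q \<equiv> 2 ^ d * exp (- \<kappa>)"
  shows "0 < q" "q < 1" "q / (1 - q) \<le> 2 ^ (d + 1) * exp (- \<kappa>)"
proof -
  show "0 < q" by (simp add: q_def)
  have "real (d + 1) \<le> real (2 ^ d)" by (subst of_nat_le_iff) (simp add: Suc_leI)
  then have "real (d + 1) \<le> \<kappa>" using assms(1) by simp
  then have "exp (real (d + 1)) \<le> exp \<kappa>" by simp
  moreover have "exp (real (d + 1)) = exp 1 ^ (d + 1)"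
    using exp_of_nat_mult[of "d + 1" "1::real"] by (simp only: mult_1_right)
  moreover have "(2::real) ^ (d + 1) \<le> exp 1 ^ (d + 1)"
    using exp_ge_add_one_self[of 1] by (intro power_mono) auto
  ultimately have "2 ^ (d + 1) \<le> exp \<kappa>" by linarith
  then have half: "q \<le> 1 / 2" by (simp add: q_def exp_minus field_simps)
  then show "q < 1" by simp
  have "q / (1 - q) \<le> q / (1 / 2)" using half \<open>0 < q\<close> by (intro divide_left_mono) auto
  then show "q / (1 - q) \<le> 2 ^ (d + 1) * exp (- \<kappa>)" by (simp add: q_def)
qed

text \<open>The rate \<open>a = 2\<^bsup>\<theta>-1\<^esup> / ln 2\<close> of the tail is chosen such that \<open>a \<cdot> M 4\<^bsup>-\<theta>\<^esup> (n + 1) ln 2 = \<kappa> (n + 1)\<close> with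
  \<open>\<kappa> = 2\<^bsup>-\<theta>-1\<^esup> M\<close>. Then the \<open>2\<^bsup>d(n+1)\<^esup>\<close> subcubes of scale \<open>n\<close> contribute at most \<open>c q\<^bsup>n+1\<^esup>\<close> with
  \<open>q = 2\<^sup>d exp (- \<kappa>)\<close>, and the series sums to at most \<open>2 c q\<close>.\<close>

lemma log_Hoelder_bound_of_diam_tail:
  fixes P :: "((real ^ 'n) \<times> (real ^ 'n)) measure measure"
  assumes weak: "weak_LRP_metric \<beta> P \<theta> D" and "0 < c"
    and tail: "\<And>r t. 0 < r \<Longrightarrow> 0 \<le> t \<Longrightarrow> measure (law P D)
      {D' \<in> continuous_pseudometrics. ennreal (t * r powr \<theta>) < diam D' (cube 0 r :: (real ^ 'n) set)}
      \<le> c * exp (- (2 powr (\<theta> - 1) / ln 2 * t))"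
    and "0 < R" and M: "2 powr (\<theta> + real CARD('n) + 1) < M"
  defines "E \<equiv> {\<xi> \<in> space P.
      (SUP (x, x') \<in> {(x, x'). x \<in> cube (- R) R \<and> x' \<in> cube (- R) R \<and> x \<noteq> x'}.
         internal_metric (D \<xi>) (cube (- R) R) x x' /
         ennreal (infnorm (x - x') powr \<theta> * ln (4 * R / infnorm (x - x')))) > ennreal M}"
  shows "E \<in> sets P" "measure P E \<le> 2 ^ (CARD('n) + 1) * c * exp (- (2 powr (- \<theta> - 1)) * M)"
proof -
  note W = weak_LRP_metricD[OF weak]
  interpret prob_space P by (rule W)
  have D: "D \<xi> \<in> continuous_pseudometrics" if "\<xi> \<in> space P" for \<xi>
    using measurable_space[OF W(2) that] by simp
  have "0 < M" using M by (rule less_trans[rotated]) simp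
  let ?Y = "cube (- R) R :: (real ^ 'n) set"
  define g :: "(real ^ 'n) \<times> (real ^ 'n) \<Rightarrow> real" where
    "g z = infnorm (fst z - snd z) powr \<theta> * ln (4 * R / infnorm (fst z - snd z))" for z
  \<comment> \<open>Distinct points of the cube lie in \<open>V\<close>, because their distance is at most \<open>2R\<close>; on \<open>V\<close> the
    logarithm is positive, so \<open>g\<close> is continuous and positive there.\<close>
  define V :: "((real ^ 'n) \<times> (real ^ 'n)) set" where
    "V = {z. 0 < infnorm (fst z - snd z)} \<inter> {z. infnorm (fst z - snd z) < 4 * R}"
  have inV: "(x, y) \<in> V" if "x \<in> ?Y" "y \<in> ?Y" "x \<noteq> y" for x y
  proof -
    have "infnorm (x - y) \<le> 2 * R"
    proof (rule infnorm_le_cart)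
      fix i show "\<bar>(x - y) $ i\<bar> \<le> 2 * R"
        using that(1,2)[unfolded mem_cube, THEN spec[of _ i]] by (simp add: abs_le_iff)
    qed
    then show ?thesis using that(3) \<open>0 < R\<close> by (simp add: V_def infnorm_pos_lt)
  qed
  have gpos: "0 < g z" if "z \<in> V" for z
    using that by (auto simp: V_def g_def intro!: mult_pos_pos ln_gt_zero)
  have cont_inf: "continuous_on S (\<lambda>z. infnorm (fst z - snd z))" for S :: "((real ^ 'n) \<times> (real ^ 'n)) set"
    by (intro continuous_intros)
  have "open V"
    unfolding V_def by (intro open_Int open_Collect_less cont_inf continuous_intros)
  have "continuous_on V (\<lambda>z. M * g z)"
    unfolding g_def by (intro continuous_intros cont_inf) (auto simp: V_def)
  then have A: "{D' \<in> continuous_pseudometrics. \<exists>x\<in>?Y. \<exists>y\<in>?Y. (x, y) \<in> V \<and>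
      ennreal (M * g (x, y)) < internal_metric D' ?Y x y} \<in> sets pseudometric_space" (is "?A \<in> _")
    using gpos \<open>0 < M\<close> \<open>open V\<close> by (intro exists_internal_metric_gt_sets compact_cube) (auto simp: less_imp_le)
  have V_ne: "(x, y) \<in> V \<Longrightarrow> x \<noteq> y" for x y by (auto simp: V_def infnorm_0)
  have "ennreal M < (SUP (x, x') \<in> {(x, x'). x \<in> ?Y \<and> x' \<in> ?Y \<and> x \<noteq> x'}.
         internal_metric (D \<xi>) ?Y x x' / ennreal (infnorm (x - x') powr \<theta> * ln (4 * R / infnorm (x - x'))))
      \<longleftrightarrow> (\<exists>x\<in>?Y. \<exists>y\<in>?Y. (x, y) \<in> V \<and> ennreal (M * g (x, y)) < internal_metric (D \<xi>) ?Y x y)" (is "?l \<longleftrightarrow> ?r") for \<xi>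
  proof -
    have "?l \<longleftrightarrow> (\<exists>x\<in>?Y. \<exists>y\<in>?Y. x \<noteq> y \<and> ennreal M < internal_metric (D \<xi>) ?Y x y / ennreal (g (x, y)))"
      by (auto simp: less_SUP_iff g_def)
    also have "\<dots> \<longleftrightarrow> ?r"
      using inV V_ne gpos \<open>0 < M\<close> ennreal_less_divide_iff[of M] by (meson less_imp_le)
    finally show ?thesis .
  qed
  then have E: "E = {\<xi> \<in> space P. D \<xi> \<in> ?A}"
    unfolding E_def using D by auto
  show E_sets: "E \<in> sets P"
    unfolding E using measurable_sets[OF W(2) A] by (simp add: vimage_def Int_def conj_commute)
  define \<kappa> where "\<kappa> = 2 powr (- \<theta> - 1) * M"
  define q where "q = 2 ^ CARD('n) * exp (- \<kappa>)"
  define t where "t n = M * 4 powr (- \<theta>) * (real (n + 1) * ln 2)" for n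
  define B where "B n = {D' \<in> continuous_pseudometrics.
      ennreal (t n * (2 * R / 2 ^ n) powr \<theta>) < diam D' (cube 0 (2 * R / 2 ^ n) :: (real ^ 'n) set)}" for n
  define I :: "nat \<Rightarrow> ('n \<Rightarrow> nat) set" where "I n = (UNIV \<rightarrow>\<^sub>E {..<2 ^ (n + 1)})" for n
  define T where "T n = (\<Union>k\<in>I n. {\<xi> \<in> space P. shift (corner R n k) (D \<xi>) \<in> B n})" for n
  have "2 powr (- \<theta> - 1) * 2 powr (\<theta> + real CARD('n) + 1) < \<kappa>"
    unfolding \<kappa>_def using M by simp
  then have "2 ^ CARD('n) < \<kappa>" by (simp add: powr_realpow flip: powr_add)
  note q = geometric_sum_bound[OF this, folded q_def]
  have t: "0 \<le> t n" for n using \<open>0 < M\<close> by (simp add: t_def)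
  have B: "B n \<in> sets pseudometric_space" for n
    unfolding B_def using t[of n] by (intro diam_gt_sets compact_cube) simp
  have at: "2 powr (\<theta> - 1) / ln 2 * t n = \<kappa> * real (n + 1)" for n
  proof -
    have "4 powr (- \<theta>) = (2 powr 2) powr (- \<theta>)" by simp
    also have "\<dots> = 2 powr (- (2 * \<theta>))" by (subst powr_powr) simp
    finally have "2 powr (\<theta> - 1) * 4 powr (- \<theta>) = 2 powr (- \<theta> - 1)"
      by (simp flip: powr_add)
    then show ?thesis by (simp add: t_def \<kappa>_def field_simps)
  qed
  have sub_meas: "(\<lambda>\<xi>. shift z (D \<xi>)) \<in> measurable P pseudometric_space" for z
    using W(2) by measurable
  have sub_sets: "{\<xi> \<in> space P. shift z (D \<xi>) \<in> B n} \<in> sets P" for z n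
    using measurable_sets[OF sub_meas B] by (simp add: vimage_def Int_def conj_commute)
  have sub_prob: "prob {\<xi> \<in> space P. shift z (D \<xi>) \<in> B n} \<le> c * exp (- \<kappa>) ^ (n + 1)" for z n
  proof -
    have "prob {\<xi> \<in> space P. shift z (D \<xi>) \<in> B n} = measure (law P D) (B n)"
      using measure_law[OF sub_meas B, of z n] W(6)[of z] by simp
    also have "\<dots> \<le> c * exp (- (\<kappa> * real (n + 1)))"
      using tail[of "2 * R / 2 ^ n" "t n"] t[of n] \<open>0 < R\<close> unfolding B_def at by simp
    also have "exp (- (\<kappa> * real (n + 1))) = exp (- \<kappa>) ^ (n + 1)"
      using exp_of_nat_mult[of "n + 1" "- \<kappa>"] by (simp only: mult_minus_right mult.commute[of \<kappa>])
    finally show ?thesis .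
  qed
  have fin: "finite (I n)" for n unfolding I_def by (intro finite_PiE) auto
  have card: "card (I n) = 2 ^ (CARD('n) * (n + 1))" for n
    unfolding I_def by (simp only: card_funcsetE finite card_lessThan power_mult[symmetric] mult.commute)
  have T_sets: "T n \<in> sets P" for n
    unfolding T_def using fin sub_sets by (intro sets.finite_UN) auto
  have T_prob: "prob (T n) \<le> c * q ^ (n + 1)" for n
  proof -
    have "prob (T n) \<le> (\<Sum>k\<in>I n. prob {\<xi> \<in> space P. shift (corner R n k) (D \<xi>) \<in> B n})"
      unfolding T_def using fin sub_sets by (rule measure_UNION_le)
    also have "\<dots> \<le> real (card (I n)) * (c * exp (- \<kappa>) ^ (n + 1))"
      using sub_prob by (intro sum_bounded_above)
    also have "real (card (I n)) = (2 ^ CARD('n)) ^ (n + 1)"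
      by (simp only: card power_mult of_nat_power of_nat_numeral)
    also have "(2 ^ CARD('n)) ^ (n + 1) * (c * exp (- \<kappa>) ^ (n + 1)) = c * q ^ (n + 1)"
      by (simp only: q_def power_mult_distrib mult_ac)
    finally show ?thesis .
  qed
  have sq: "summable (\<lambda>n. c * q ^ (n + 1))"
    using q(1,2) by (intro summable_mult) (simp add: summable_geometric summable_mult)
  then have sT: "summable (\<lambda>n. prob (T n))"
    by (rule summable_comparison_test'[where N = 0]) (use T_prob in simp)
  have "E \<subseteq> (\<Union>n. T n)"
  proof
    fix \<xi> assume "\<xi> \<in> E"
    then obtain x y where xy: "\<xi> \<in> space P" "x \<in> ?Y" "y \<in> ?Y" "(x, y) \<in> V"
        "ennreal (M * g (x, y)) < internal_metric (D \<xi>) ?Y x y"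
      unfolding E by blast
    obtain n k where nk: "\<forall>i. k i < 2 ^ (n + 1)"
      "ennreal (t n * (2 * R / 2 ^ n) powr \<theta>) < diam (shift (corner R n k) (D \<xi>)) (cube 0 (2 * R / 2 ^ n))"
      using large_ratio_large_subcube[OF \<open>0 < R\<close> \<open>0 < M\<close> W(3) xy(2,3) V_ne[OF xy(4)]
          xy(5)[unfolded g_def fst_conv snd_conv]]
      unfolding t_def by blast
    then show "\<xi> \<in> (\<Union>n. T n)"
      using xy(1) D[OF xy(1)] shift_continuous_pseudometrics
      by (auto simp: T_def I_def B_def intro!: exI[of _ n] bexI[of _ k])
  qed
  then have "prob E \<le> prob (\<Union>n. T n)" using T_sets by (intro finite_measure_mono) auto
  also have "\<dots> \<le> (\<Sum>n. prob (T n))"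
    using T_sets sT by (intro finite_measure_subadditive_countably) auto
  also have "\<dots> \<le> (\<Sum>n. c * q ^ (n + 1))"
    using T_prob sT sq by (intro suminf_le)
  also have "(\<Sum>n. c * q ^ (n + 1)) = c * (q / (1 - q))"
  proof -
    have "(\<lambda>n. c * q * q ^ n) sums (c * q * (1 / (1 - q)))"
      using q(1,2) by (intro sums_mult geometric_sums) simp
    then show ?thesis by (simp add: sums_iff mult_ac)
  qed
  also have "\<dots> \<le> c * (2 ^ (CARD('n) + 1) * exp (- \<kappa>))"
    using q(3) \<open>0 < c\<close> by (intro mult_left_mono) auto
  finally show "prob E \<le> 2 ^ (CARD('n) + 1) * c * exp (- (2 powr (- \<theta> - 1)) * M)"
    by (simp add: \<kappa>_def mult_ac)
qed

theorem proposition1p13: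
  shows "\<exists>C :: (real ^ 'n \<Rightarrow> real ^ 'n \<Rightarrow> real) measure \<Rightarrow> real.
    (\<forall>L. 0 < C L) \<and>
    (\<forall>\<beta> P \<theta> D. 0 < \<beta> \<longrightarrow> weak_LRP_metric \<beta> P \<theta> D \<longrightarrow>
      (\<forall>R M. 0 < R \<longrightarrow> 2 powr (\<theta> + real CARD('n) + 1) < M \<longrightarrow>
        (let E = {\<xi> \<in> space P.
              (SUP (x, x') \<in> {(x, x'). x \<in> cube (- R) R \<and> x' \<in> cube (- R) R \<and> x \<noteq> x'}.
                 internal_metric (D \<xi>) (cube (- R) R) x x' /
                 ennreal (infnorm (x - x') powr \<theta> * ln (4 * R / infnorm (x - x')))) > ennreal M}
         in E \<in> sets P \<and>
            measure P E \<le> 2 ^ (CARD('n) + 1) * C (law P D) * exp (- (2 powr (- \<theta> - 1)) * M))))"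
proof -
  \<comment> \<open>For a law that arises from a weak metric, all representations of the law share one \<open>\<theta>\<close>, so one of
    them provides a constant that serves them all.\<close>
  define good where "good L c \<longleftrightarrow> 0 < c \<and> (\<forall>\<beta> P \<theta> D. weak_LRP_metric \<beta> P \<theta> D \<longrightarrow> law P D = L \<longrightarrow>
      (\<forall>r>0. \<forall>t\<ge>0. measure L
        {D' \<in> continuous_pseudometrics. ennreal (t * r powr \<theta>) < diam D' (cube 0 r)}
        \<le> c * exp (- (2 powr (\<theta> - 1) / ln 2 * t))))"
    for L :: "(real ^ 'n \<Rightarrow> real ^ 'n \<Rightarrow> real) measure" and c
  have "\<exists>c. good L c" for L
  proof (cases "\<exists>\<beta> P \<theta> D. weak_LRP_metric \<beta> P \<theta> D \<and> law P D = L")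
    case True
    then obtain \<beta> P \<theta> D where weak: "weak_LRP_metric \<beta> P \<theta> D" and L: "law P D = L" by blast
    have uniq: "\<theta>' = \<theta>" if "weak_LRP_metric \<beta>' P' \<theta>' D'" "law P' D' = L" for \<beta>' P' \<theta>' D'
      using exponent_le_of_same_law[OF weak that(1)] exponent_le_of_same_law[OF that(1) weak] that(2) L by auto
    have nonneg: "0 \<le> 2 powr (\<theta> - 1) / ln 2" by simp
    obtain c where "0 < c" "\<And>r t. 0 < r \<Longrightarrow> 0 \<le> t \<Longrightarrow> measure L
        {D' \<in> continuous_pseudometrics. ennreal (t * r powr \<theta>) < diam D' (cube 0 r)}
        \<le> c * exp (- (2 powr (\<theta> - 1) / ln 2 * t))"
      using law_diam_tail[OF weak nonneg] unfolding L by blast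
    then have "good L c" unfolding good_def using uniq by blast
    then show ?thesis ..
  next
    case False
    then have "good L 1" unfolding good_def by auto
    then show ?thesis ..
  qed
  then obtain C where C: "\<And>L. good L (C L)" by metis
  have pos: "\<forall>L. 0 < C L" using C unfolding good_def by blast
  have tail: "measure (law P D)
      {D' \<in> continuous_pseudometrics. ennreal (t * r powr \<theta>) < diam D' (cube 0 r)}
      \<le> C (law P D) * exp (- (2 powr (\<theta> - 1) / ln 2 * t))"
    if "weak_LRP_metric \<beta> P \<theta> D" "0 < r" "0 \<le> t" for \<beta> \<theta> r t :: real and D and P :: "((real ^ 'n) \<times> (real ^ 'n)) measure measure"
    using C[of "law P D"] that unfolding good_def by blast
  show ?thesis
    unfolding Let_def
  proof (intro exI[of _ C] conjI[OF pos] allI impI)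
    fix \<beta> \<theta> R M :: real and P :: "((real ^ 'n) \<times> (real ^ 'n)) measure measure" and D
    assume weak: "weak_LRP_metric \<beta> P \<theta> D" and "0 < R" "2 powr (\<theta> + real CARD('n) + 1) < M"
    from log_Hoelder_bound_of_diam_tail[OF weak spec[OF pos] tail[OF weak] this(2,3)]
    show "{\<xi> \<in> space P.
        (SUP (x, x') \<in> {(x, x'). x \<in> cube (- R) R \<and> x' \<in> cube (- R) R \<and> x \<noteq> x'}.
           internal_metric (D \<xi>) (cube (- R) R) x x' /
           ennreal (infnorm (x - x') powr \<theta> * ln (4 * R / infnorm (x - x')))) > ennreal M} \<in> sets P \<and>
      measure P {\<xi> \<in> space P.
        (SUP (x, x') \<in> {(x, x'). x \<in> cube (- R) R \<and> x' \<in> cube (- R) R \<and> x \<noteq> x'}.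
           internal_metric (D \<xi>) (cube (- R) R) x x' /
           ennreal (infnorm (x - x') powr \<theta> * ln (4 * R / infnorm (x - x')))) > ennreal M}
        \<le> 2 ^ (CARD('n) + 1) * C (law P D) * exp (- (2 powr (- \<theta> - 1)) * M)"
      by (intro conjI)
  qed
qed

end
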